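(* There exists a universal constant $C>0$ such that for all rational $x\in(0,1)$, \[ \left| h(x)-\frac{\mathrm{Vol}(4_1)}{2\pi x}\right| \le C\left(1+|\log x|\right). \]
   Context: For a real number $x$ define $\mathbf{J}_{4_1}(x)=\sum_{n=0}^{\infty}\prod_{k=1}^{n}\left|1-e^{2\pi i k x}\right|^2$; for rational $x$ this sum is finite and at least $1$. Define $h(x)=\log\frac{\mathbf{J}_{4_1}(x)}{\mathbf{J}_{4_1}(1/x)}$ for $x\in\mathbb{Q}\setminus\{0\}$. The constant $\mathrm{Vol}(4_1)$ (the hyperbolic volume of the complement of the figure-eight knot) is $\mathrm{Vol}(4_1)=4\pi\int_0^{5/6}\log(2\sin(\pi t))\,\mathrm{d}t\approx 2.0299$. *)

theory Defs
  imports "HOL-Analysis.Analysis"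
begin

text \<open>
  For rational arguments all but finitely many terms of the series vanish
  (lemma \<open>J41_summable\<close> below), so \<^const>\<open>suminf\<close> is the true sum there. For
  irrational arguments no meaning is claimed for divergent series; only
  rational arguments are relevant.
\<close>

definition J41_term :: "real \<Rightarrow> nat \<Rightarrow> real" where
  "J41_term x n = (\<Prod>k=1..n. (cmod (1 - exp (2 * of_real pi * \<i> * of_nat k * of_real x)))\<^sup>2)"

definition J41 :: "real \<Rightarrow> real" where
  "J41 x = (\<Sum>n. J41_term x n)"

definition h :: "real \<Rightarrow> real" where
  "h x = ln (J41 x / J41 (1 / x))"

text \<open>
  The integrand has an integrable logarithmic singularity at the left end
  point, where \<^term>\<open>ln (0::real)\<close> is a junk value that does not affect the integral.
\<close>

definition Vol41 :: real where
  "Vol41 = 4 * pi * integral {0..5/6} (\<lambda>t. ln (2 * sin (pi * t)))"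

lemma J41_term_0: "J41_term x 0 = 1"
  by (simp add: J41_term_def)

lemma J41_term_nonneg: "J41_term x n \<ge> 0"
  by (simp add: J41_term_def prod_nonneg)

lemma J41_term_eventually_0:
  assumes "x \<in> \<rat>"
  shows "\<exists>b. \<forall>n\<ge>b. J41_term x n = 0"
proof -
  from assms obtain r where r: "x = of_rat r"
    by (auto elim: Rats_cases)
  obtain a b where ab: "quotient_of r = (a, b)"
    by force
  then have b: "b > 0"
    by (rule quotient_of_denom_pos)
  have x: "x = real_of_int a / real_of_int b"
    using quotient_of_div[OF ab] by (simp add: r of_rat_divide)
  have bx: "real (nat b) * x = real_of_int a"
    using b by (simp add: x)
  have "of_nat (nat b) * of_real x = (of_int a :: complex)"
    using arg_cong[OF bx, of complex_of_real] by simp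
  then have "2 * of_real pi * \<i> * of_nat (nat b) * of_real x
      = 2 * of_int a * of_real pi * \<i>"
    by (simp add: mult.assoc)
  then have e: "exp (2 * of_real pi * \<i> * of_nat (nat b) * of_real x) = 1"
    using exp_integer_2pi[of "of_int a"]
    by (simp only: Ints_of_int of_real_mult of_real_numeral of_real_of_int_eq simp_thms)
  have "J41_term x n = 0" if "n \<ge> nat b" for n
    unfolding J41_term_def
    by (rule prod_zero) (use that b e in \<open>auto intro!: bexI[of _ "nat b"]\<close>)
  then show ?thesis by blast
qed

lemma J41_summable:
  assumes "x \<in> \<rat>"
  shows "summable (J41_term x)"
proof -
  obtain b where "\<forall>n\<ge>b. J41_term x n = 0"
    using J41_term_eventually_0[OF assms] by blast
  then show ?thesis
    by (intro summable_finite[of "{..<b}"]) auto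
qed

lemma J41_ge_1:
  assumes "x \<in> \<rat>"
  shows "J41 x \<ge> 1"
  using sum_le_suminf[OF J41_summable[OF assms], of "{0}"]
  by (simp add: J41_def J41_term_0 J41_term_nonneg)

end

theory Submission
  imports Defs "HOL-Real_Asymp.Real_Asymp"
begin

text \<open>
  Write \<open>P n x\<close> for the product of the \<open>2 \<bar>sin (\<pi> k x)\<bar>\<close> with \<open>1 \<le> k \<le> n\<close>, so that \<open>J41 x\<close> is the sum
  of the \<open>(P n x)\<^sup>2\<close>. The double sine function \<open>S\<close> with periods \<open>1\<close> and \<open>x\<close> satisfies
  \<open>S (z + x) = 2 sin (\<pi> z) S z\<close> and \<open>S (z + 1) = 2 sin (\<pi> z / x) S z\<close>, whence
  \<open>P n x / P m (1/x) = S ((n + 1) x - m) / S x\<close> with \<open>S x = sqrt x\<close>, as long as the argument lies in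
  \<open>(0, 1 + x)\<close>. There \<open>ln S\<close> is odd about the centre \<open>(1 + x)/2\<close> and concave to the right of it, which
  bounds it on the central interval of length \<open>x\<close>; elsewhere the first functional equation turns it
  into a Riemann sum of \<open>ln (2 sin (\<pi> t))\<close>, whose largest value, near \<open>5/6\<close>, is \<open>Vol41 / (4 \<pi> x)\<close> up
  to a bounded error. Matching every \<open>n\<close> with \<open>m = \<lfloor>n x\<rfloor>\<close> gives the upper bound for
  \<open>J41 x / J41 (1/x)\<close>; matching every \<open>m\<close> with an \<open>n\<close> for which the argument is near \<open>5/6\<close>
  (or in the central unit interval, if \<open>x\<close> is not small) gives the lower bound.
\<close>

section \<open>Stirling's formula for the real Gamma function\<close>

lemma ln_Gamma_plus1_real: "x > 0 \<Longrightarrow> ln_Gamma (x + 1) = ln x + ln_Gamma (x::real)"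
proof -
  assume "x > 0"
  moreover from this have "Gamma (x + 1) = x * Gamma x"
    by (intro Gamma_plus1) (auto elim!: nonpos_Ints_cases)
  ultimately show ?thesis
    using Gamma_real_pos[of x] by (simp add: ln_Gamma_real_pos ln_mult_pos)
qed

lemma ln_Gamma_reflection_real:
  assumes "0 < x" "x < 1"
  shows "ln_Gamma x + ln_Gamma (1 - x) = ln pi - ln (sin (pi * x))"
proof -
  have "complex_of_real (Gamma x * Gamma (1 - x)) = of_real (pi / sin (pi * x))"
  proof -
    have "Gamma (1 - complex_of_real x) = of_real (Gamma (1 - x))"
      using Gamma_complex_of_real[of "1 - x"] by simp
    moreover have "sin (complex_of_real pi * of_real x) = of_real (sin (pi * x))"
      using sin_of_real[of "pi * x", where 'a = complex] by simp
    ultimately show ?thesis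
      using Gamma_reflection_complex[of "of_real x"] by (simp add: Gamma_complex_of_real)
  qed
  then have eq: "Gamma x * Gamma (1 - x) = pi / sin (pi * x)"
    by (simp only: of_real_eq_iff)
  have "sin (pi * x) > 0"
    using assms by (intro sin_gt_zero) auto
  then show ?thesis
    using arg_cong[OF eq, of ln] Gamma_real_pos[of x] Gamma_real_pos[of "1 - x"] assms
    by (simp add: ln_mult_pos ln_div ln_Gamma_real_pos)
qed

text \<open>Legendre's duplication formula in logarithmic form. It serves to identify the constant
  in Stirling's formula.\<close>

lemma ln_Gamma_duplication_real:
  assumes "x > 0"
  shows "ln_Gamma x + ln_Gamma (x + 1/2) = (1 - 2 * x) * ln 2 + ln pi / 2 + ln_Gamma (2 * x)"
proof -
  have "complex_of_real (Gamma x * Gamma (x + 1/2))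
      = of_real (exp ((1 - 2 * x) * ln 2) * sqrt pi * Gamma (2 * x))"
  proof -
    have "x \<notin> \<int>\<^sub>\<le>\<^sub>0" "x + 1/2 \<notin> \<int>\<^sub>\<le>\<^sub>0"
      using assms nonpos_Ints_nonpos[of x] nonpos_Ints_nonpos[of "x + 1/2"] by auto
    then have 1: "complex_of_real x \<notin> \<int>\<^sub>\<le>\<^sub>0" and "complex_of_real (x + 1/2) \<notin> \<int>\<^sub>\<le>\<^sub>0"
      by (simp_all only: of_real_in_nonpos_Ints_iff not_False_eq_True)
    then have 2: "complex_of_real x + 1/2 \<notin> \<int>\<^sub>\<le>\<^sub>0"
      by simp
    have "Gamma (complex_of_real x + 1/2) = of_real (Gamma (x + 1/2))"
      using Gamma_complex_of_real[of "x + 1/2"] by simp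
    moreover have "Gamma (2 * complex_of_real x) = of_real (Gamma (2 * x))"
      using Gamma_complex_of_real[of "2 * x"] by simp
    moreover have "exp ((1 - 2 * complex_of_real x) * of_real (ln 2)) = of_real (exp ((1 - 2 * x) * ln 2))"
      by (simp flip: exp_of_real)
    ultimately show ?thesis
      using Gamma_legendre_duplication[OF 1 2] by (simp add: Gamma_complex_of_real)
  qed
  then have eq: "Gamma x * Gamma (x + 1/2) = exp ((1 - 2 * x) * ln 2) * sqrt pi * Gamma (2 * x)"
    by (simp only: of_real_eq_iff)
  have pos: "Gamma x > 0" "Gamma (x + 1/2) > 0" "Gamma (2 * x) > 0"
    using assms by (auto intro!: Gamma_real_pos)
  have "ln_Gamma x + ln_Gamma (x + 1/2) = ln (Gamma x * Gamma (x + 1/2))"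
    using assms pos by (simp add: ln_mult_pos ln_Gamma_real_pos)
  also have "\<dots> = ln (exp ((1 - 2 * x) * ln 2)) + ln (sqrt pi) + ln (Gamma (2 * x))"
    unfolding eq using pos by (subst ln_mult_pos, simp, simp)+ simp
  finally show ?thesis
    using assms by (simp add: ln_sqrt ln_Gamma_real_pos)
qed

text \<open>The remainder in Stirling's formula with the constant \<open>ln (2 * pi) / 2\<close>
  left in, so that its limit at infinity is that constant.\<close>

definition stirling_rest :: "real \<Rightarrow> real" where
  "stirling_rest t = ln_Gamma t - ((t - 1/2) * ln t - t)"

lemma stirling_rest_step:
  assumes "t > 0"
  shows "stirling_rest t - stirling_rest (t + 1) = (t + 1/2) * (ln (t + 1) - ln t) - 1"
  using ln_Gamma_plus1_real[OF assms] by (simp add: stirling_rest_def algebra_simps)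

text \<open>\<open>ln (t + 1) - ln t\<close> is the integral of the convex function
  \<open>1 / s\<close> over a unit interval. The midpoint rule bounds it from below and gives the
  first claim; the trapezoidal rule bounds it from above, with an excess that telescopes as
  \<open>1 / (4 * t)\<close>.\<close>

lemma stirling_rest_step_bounds:
  assumes "t > 0"
  shows "stirling_rest (t + 1) \<le> stirling_rest t"
    and "stirling_rest t - 1 / (4 * t) \<le> stirling_rest (t + 1) - 1 / (4 * (t + 1))"
proof -
  have "(t + 1/2) * (2 / (2 * t + 1)) \<le> (t + 1/2) * (ln (t + 1) - ln t)"
    using ln_inverse_approx_ge[of t "t + 1"] assms
    by (intro mult_left_mono) (auto simp: algebra_simps)
  moreover have "(t + 1/2) * (2 / (2 * t + 1)) = 1"
    using assms by (simp add: divide_simps)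
  ultimately show "stirling_rest (t + 1) \<le> stirling_rest t"
    using stirling_rest_step[OF assms] by linarith
  have "(t + 1/2) * (ln (t + 1) - ln t) \<le> (t + 1/2) * ((inverse t + inverse (t + 1)) / 2)"
    using ln_inverse_approx_le[of t 1] assms by (intro mult_left_mono) auto
  also have "\<dots> = 1 + (1 / (4 * t) - 1 / (4 * (t + 1)))"
  proof -
    have "(t + 1/2) * ((inverse t + inverse (t + 1)) / 2) - 1 = 1 / (4 * (t * (t + 1)))"
      "1 / (4 * t) - 1 / (4 * (t + 1)) = 1 / (4 * (t * (t + 1)))"
      using assms by (simp_all add: divide_simps) (simp_all add: algebra_simps)
    then show ?thesis by linarith
  qed
  finally show "stirling_rest t - 1 / (4 * t) \<le> stirling_rest (t + 1) - 1 / (4 * (t + 1))"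
    using stirling_rest_step[OF assms] by simp
qed

text \<open>The sequence decreases, while subtracting \<open>1 / (4 * n)\<close> makes it increase,
  so it is bounded below.\<close>

lemma stirling_rest_nat_convergent: "convergent (\<lambda>n. stirling_rest (real (Suc n)))"
proof -
  let ?r = "\<lambda>n. stirling_rest (real (Suc n))"
  have dec: "decseq ?r"
  proof (rule decseq_SucI)
    show "?r (Suc n) \<le> ?r n" for n
      using stirling_rest_step_bounds(1)[of "real (Suc n)"] by (simp add: add.commute)
  qed
  have inc: "incseq (\<lambda>n. ?r n - 1 / (4 * real (Suc n)))"
  proof (rule incseq_SucI)
    show "?r n - 1 / (4 * real (Suc n)) \<le> ?r (Suc n) - 1 / (4 * real (Suc (Suc n)))" for n
      using stirling_rest_step_bounds(2)[of "real (Suc n)"] by (simp only: of_nat_Suc[of "Suc n"] add.commute[of 1])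
  qed
  have "?r 0 - 1/4 \<le> ?r n" for n
  proof -
    have "?r 0 - 1/4 \<le> ?r n - 1 / (4 * real (Suc n))"
      using incseqD[OF inc, of 0 n] by simp
    also have "\<dots> \<le> ?r n"
      by simp
    finally show ?thesis .
  qed
  then obtain L where "?r \<longlonglongrightarrow> L"
    using decseq_convergent[OF dec] by metis
  then show ?thesis
    by (rule convergentI)
qed

text \<open>Log-convexity of Gamma: the upper bound is the chord from \<open>n\<close> to
  \<open>n + 1\<close>; the lower bound places \<open>n\<close> on the chord from
  \<open>n - 1\<close> to \<open>n + u\<close>.\<close>

lemma ln_Gamma_between:
  assumes "n > 1" "0 \<le> u" "u \<le> 1"
  shows "ln_Gamma (n + u) \<le> ln_Gamma n + u * ln (n::real)"
    and "ln_Gamma n + u * ln (n - 1) \<le> ln_Gamma (n + u)"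
proof -
  have conv: "convex_on {0<..} (ln_Gamma :: real \<Rightarrow> real)"
    by (rule convex_on_realI[of _ _ Digamma]) (auto intro!: derivative_eq_intros Digamma_real_mono)
  have "ln_Gamma ((1 - u) *\<^sub>R n + u *\<^sub>R (n + 1)) \<le> (1 - u) * ln_Gamma n + u * ln_Gamma (n + 1)"
    using assms by (intro convex_onD[OF conv]) auto
  then show "ln_Gamma (n + u) \<le> ln_Gamma n + u * ln n"
    using assms ln_Gamma_plus1_real[of n] by (simp add: algebra_simps)
  \<comment> \<open>The weight that writes \<open>n\<close> as a convex combination of
    \<open>n + u\<close> and \<open>n - 1\<close>.\<close>
  let ?v = "u / (1 + u)"
  have "?v * (1 + u) = u"
    using assms by simp
  then have v: "(1 - ?v) *\<^sub>R (n + u) + ?v *\<^sub>R (n - 1) = n"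
    by (simp only: real_scaleR_def left_diff_distrib right_diff_distrib distrib_left distrib_right mult_1)
  have "ln_Gamma ((1 - ?v) *\<^sub>R (n + u) + ?v *\<^sub>R (n - 1)) \<le> (1 - ?v) * ln_Gamma (n + u) + ?v * ln_Gamma (n - 1)"
    using assms by (intro convex_onD[OF conv]) auto
  then have "ln_Gamma n \<le> (1 - ?v) * ln_Gamma (n + u) + ?v * ln_Gamma (n - 1)"
    by (simp only: v)
  moreover have "1 - ?v = 1 / (1 + u)"
    using assms by (simp add: field_simps)
  ultimately have "ln_Gamma n \<le> (ln_Gamma (n + u) + u * ln_Gamma (n - 1)) / (1 + u)"
    by (simp add: add_divide_distrib)
  then have "(1 + u) * ln_Gamma n \<le> ln_Gamma (n + u) + u * ln_Gamma (n - 1)"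
    using assms by (simp add: pos_le_divide_eq mult.commute)
  then show "ln_Gamma n + u * ln (n - 1) \<le> ln_Gamma (n + u)"
    using assms ln_Gamma_plus1_real[of "n - 1"] by (simp add: algebra_simps)
qed

text \<open>This carries the limit from integers to real arguments. The term \<open>u * ln n\<close>
  of \<open>ln_Gamma_between\<close> cancels the main terms, and \<open>ln y \<le> y - 1\<close>
  makes every remaining difference of logarithms of order \<open>1 / n\<close>.\<close>

lemma stirling_rest_between:
  assumes "n > 1" "0 \<le> u" "u \<le> 1"
  shows "\<bar>stirling_rest (n + u) - stirling_rest n\<bar> \<le> 3 / (n - 1)"
proof -
  have "n > 0" using assms by simp
  have t: "n + u > 0" "n + u \<ge> 1" using assms by auto
  have a: "ln n - ln (n + u) \<le> - u / (n + u)"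
    using ln_le_minus_one[of "n / (n + u)"] assms by (simp add: ln_div field_simps)
  have b: "ln n - ln (n + u) \<ge> - u / n"
    using ln_le_minus_one[of "(n + u) / n"] assms by (simp add: ln_div field_simps)
  have c: "ln n - ln (n - 1) \<le> 1 / (n - 1)"
    using ln_le_minus_one[of "n / (n - 1)"] assms by (simp add: ln_div field_simps)
  have eq: "stirling_rest (n + u) - stirling_rest n
      = ln_Gamma (n + u) - ln_Gamma n - u * ln n + (n + u - 1/2) * (ln n - ln (n + u)) + u"
    by (simp add: stirling_rest_def algebra_simps)
  have "(n + u - 1/2) * (ln n - ln (n + u)) \<le> (n + u - 1/2) * (- u / (n + u))"
    using a assms by (intro mult_left_mono) auto
  also have "\<dots> = - u + u / (2 * (n + u))"
    using t by (simp add: field_simps)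
  also have "u / (2 * (n + u)) \<le> 3 / (n - 1)"
    using assms by (intro frac_le) auto
  finally have upper: "stirling_rest (n + u) - stirling_rest n \<le> 3 / (n - 1)"
    using ln_Gamma_between(1)[OF assms] eq by simp
  have "- u - u / n \<le> (n + u - 1/2) * (- u / n)"
  proof -
    have "u * (n + u - 1/2) \<le> u * (n + 1)" using assms by (intro mult_left_mono) auto
    then have "- (u * (n + 1)) / n \<le> - (u * (n + u - 1/2)) / n"
      using \<open>n > 0\<close> by (intro divide_right_mono) auto
    moreover have "- (u * (n + 1)) / n = - u - u / n"
      using \<open>n > 0\<close> by (simp add: field_simps)
    moreover have "- (u * (n + u - 1/2)) / n = (n + u - 1/2) * (- u / n)"
      by (simp add: mult.commute)
    ultimately show ?thesis by linarith
  qed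
  also have "\<dots> \<le> (n + u - 1/2) * (ln n - ln (n + u))"
    using b assms by (intro mult_left_mono) auto
  finally have 1: "- u - u / n \<le> (n + u - 1/2) * (ln n - ln (n + u))" .
  have 2: "u / n \<le> 1 / (n - 1)"
    using assms by (intro frac_le) auto
  have 3: "u * (ln n - ln (n - 1)) \<le> 1 * (1 / (n - 1))"
    using c assms by (intro mult_mono) auto
  have "0 \<le> 1 / (n - 1)" "3 / (n - 1) = 3 * (1 / (n - 1))" using assms by simp_all
  moreover have "u * ln n - u * ln (n - 1) \<le> 1 / (n - 1)"
    using 3 by (simp only: right_diff_distrib mult_1)
  moreover have "ln_Gamma n + u * ln (n - 1) \<le> ln_Gamma (n + u)"
    by (rule ln_Gamma_between(2)[OF assms])
  moreover define A where "A = (n + u - 1/2) * (ln n - ln (n + u))"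
  moreover define U where "U = u * ln n"
  moreover define V where "V = u * ln (n - 1)"
  ultimately have "- (3 / (n - 1)) \<le> stirling_rest (n + u) - stirling_rest n"
    using 1 2 unfolding eq A_def[symmetric] U_def[symmetric] V_def[symmetric] by linarith
  with upper show ?thesis by (simp add: abs_le_iff)
qed

text \<open>Convergence to some \<kappa> comes from the integers. In the combination of remainders
  at \<open>t\<close>, \<open>t + 1/2\<close> and \<open>2 * t\<close> the limit is again \<kappa>,
  and the duplication formula turns it into an elementary expression whose limit is
  computable.\<close>

lemma stirling_rest_tendsto: "(stirling_rest \<longlongrightarrow> ln (2 * pi) / 2) at_top"
proof -
  obtain \<kappa> where "(\<lambda>n. stirling_rest (real (Suc n))) \<longlonglongrightarrow> \<kappa>"
    using stirling_rest_nat_convergent by (auto simp: convergent_def)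
  then have nat_lim: "(\<lambda>n. stirling_rest (real n)) \<longlonglongrightarrow> \<kappa>"
    by (subst (asm) filterlim_sequentially_Suc)
  have fl: "filterlim (\<lambda>t::real. nat \<lfloor>t\<rfloor>) sequentially at_top"
    by (rule filterlim_compose[OF filterlim_nat_sequentially filterlim_floor_sequentially])
  have floor_lim: "((\<lambda>t. stirling_rest (real (nat \<lfloor>t::real\<rfloor>))) \<longlongrightarrow> \<kappa>) at_top"
    by (rule filterlim_compose[OF nat_lim fl])
  have "((\<lambda>t. stirling_rest t - stirling_rest (real (nat \<lfloor>t\<rfloor>))) \<longlongrightarrow> 0) at_top"
  proof (rule Lim_null_comparison)
    show "\<forall>\<^sub>F t in at_top. norm (stirling_rest t - stirling_rest (real (nat \<lfloor>t\<rfloor>))) \<le> 3 / (t - 2)"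
      using eventually_gt_at_top[of 3]
    proof eventually_elim
      case (elim t)
      let ?n = "real (nat \<lfloor>t\<rfloor>)"
      have "?n = of_int \<lfloor>t\<rfloor>" using elim by simp
      then have n: "?n > t - 1" "?n \<le> t" by linarith+
      have "\<bar>stirling_rest (?n + (t - ?n)) - stirling_rest ?n\<bar> \<le> 3 / (?n - 1)"
        using n elim by (intro stirling_rest_between) linarith+
      also have "\<dots> \<le> 3 / (t - 2)"
        using n elim by (intro frac_le) linarith+
      finally show ?case by simp
    qed
    show "((\<lambda>t::real. 3 / (t - 2)) \<longlongrightarrow> 0) at_top"
      by real_asymp
  qed
  from tendsto_add[OF this floor_lim] have lim: "(stirling_rest \<longlongrightarrow> \<kappa>) at_top"
    by simp
  have "((\<lambda>t. stirling_rest t + stirling_rest (t + 1/2) - stirling_rest (2 * t)) \<longlongrightarrow> \<kappa> + \<kappa> - \<kappa>) at_top"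
    by (intro tendsto_intros lim filterlim_compose[OF lim]) real_asymp+
  moreover have "\<forall>\<^sub>F t in at_top. stirling_rest t + stirling_rest (t + 1/2) - stirling_rest (2 * t)
      = (ln 2 + ln pi) / 2 + (1/2 + t * ln t - t * ln (t + 1/2))"
    using eventually_gt_at_top[of 0]
  proof eventually_elim
    case (elim t)
    \<comment> \<open>Here \<open>A\<close>, \<open>B\<close>, \<open>C\<close> stand for
      \<open>ln_Gamma\<close> at \<open>t\<close>, \<open>t + 1/2\<close>, \<open>2 * t\<close>;
      \<open>L\<close>, \<open>M\<close>, \<open>l\<close>, \<open>p\<close> for the logarithms of
      \<open>t\<close>, \<open>t + 1/2\<close>, \<open>2\<close>, \<open>pi\<close>.\<close>
    have ring: "A - ((t - 1/2) * L - t) + (B - (t * M - (t + 1/2))) - (C - ((2 * t - 1/2) * (l + L) - 2 * t))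
        = (l + p) / 2 + (1/2 + t * L - t * M)" if "A + B = (1 - 2 * t) * l + p / 2 + C" for A B C L M l p :: real
    proof -
      have "A = (1 - 2 * t) * l + p / 2 + C - B" using that by simp
      then show ?thesis by (simp add: field_simps)
    qed
    have 1: "ln (2 * t) = ln 2 + ln t" "t + 1/2 - 1/2 = t"
      using elim by (simp_all add: ln_mult_pos)
    show ?case
      unfolding stirling_rest_def 1 by (rule ring[OF ln_Gamma_duplication_real[OF elim]])
  qed
  ultimately have "((\<lambda>t. (ln 2 + ln pi) / 2 + (1/2 + t * ln t - t * ln (t + 1/2))) \<longlongrightarrow> \<kappa> + \<kappa> - \<kappa>) at_top"
    by (rule Lim_transform_eventually)
  moreover have "((\<lambda>t::real. 1/2 + t * ln t - t * ln (t + 1/2)) \<longlongrightarrow> 0) at_top"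
    by real_asymp
  then have "((\<lambda>t::real. (ln 2 + ln pi) / 2 + (1/2 + t * ln t - t * ln (t + 1/2))) \<longlongrightarrow> (ln 2 + ln pi) / 2 + 0) at_top"
    by (rule tendsto_add[OF tendsto_const])
  ultimately have "\<kappa> + \<kappa> - \<kappa> = (ln 2 + ln pi) / 2 + 0"
    by (rule tendsto_unique[OF trivial_limit_at_top_linorder])
  then have "\<kappa> = ln (2 * pi) / 2"
    by (simp add: ln_mult_pos)
  with lim show ?thesis by simp
qed

lemma ln_Gamma_shift_asymp:
  fixes u :: real
  shows "((\<lambda>t. ln_Gamma (u + t) - ((t + u - 1/2) * ln t - t)) \<longlongrightarrow> ln (2 * pi) / 2) at_top"
proof -
  have "filterlim (\<lambda>t. u + t) at_top at_top"
    by real_asymp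
  then have "((\<lambda>t. stirling_rest (u + t)) \<longlongrightarrow> ln (2 * pi) / 2) at_top"
    by (rule filterlim_compose[OF stirling_rest_tendsto])
  moreover have "((\<lambda>t. ((u + t) - 1/2) * ln (u + t) - (u + t) - ((t + u - 1/2) * ln t - t)) \<longlongrightarrow> 0) at_top"
    by real_asymp
  ultimately have "((\<lambda>t. stirling_rest (u + t) + (((u + t) - 1/2) * ln (u + t) - (u + t) - ((t + u - 1/2) * ln t - t)))
     \<longlongrightarrow> ln (2 * pi) / 2 + 0) at_top"
    by (rule tendsto_add)
  moreover have "stirling_rest (u + t) + (((u + t) - 1/2) * ln (u + t) - (u + t) - ((t + u - 1/2) * ln t - t))
      = ln_Gamma (u + t) - ((t + u - 1/2) * ln t - t)" for t
    by (simp add: stirling_rest_def)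
  ultimately show ?thesis
    by (simp only: add_0_right)
qed

text \<open>For the arguments \<open>u\<close> and \<open>1 - u\<close> the terms in
  \<open>u * ln t\<close> cancel. Such pairs are what remains at the upper end when the shifts of
  \<open>ln_dsine\<close> are summed.\<close>

lemma ln_Gamma_pair_asymp:
  fixes u :: real
  shows "((\<lambda>t. ln_Gamma (u + t) + ln_Gamma (1 - u + t) - 2 * t * (ln t - 1)) \<longlongrightarrow> ln (2 * pi)) at_top"
proof -
  have "((\<lambda>t. (ln_Gamma (u + t) - ((t + u - 1/2) * ln t - t))
      + (ln_Gamma (1 - u + t) - ((t + (1 - u) - 1/2) * ln t - t))) \<longlongrightarrow> ln (2 * pi) / 2 + ln (2 * pi) / 2) at_top"
    by (intro tendsto_add ln_Gamma_shift_asymp)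
  then show ?thesis
    by (simp add: algebra_simps)
qed

section \<open>The truncated double sine function\<close>

text \<open>
  A truncation of the logarithm of the double sine function with periods \<open>1\<close> and \<open>x\<close>, symmetric
  about \<open>(1 + x)/2\<close>. The linear term is dictated by Stirling's formula: with it, both
  functional equations hold in the limit \<open>N \<longlonglongrightarrow> \<infinity>\<close>.
\<close>

definition ln_dsine :: "real \<Rightarrow> nat \<Rightarrow> real \<Rightarrow> real" where
  "ln_dsine x N z = (\<Sum>l<N. ln_Gamma (z + real l * x) - ln_Gamma (1 + x - z + real l * x))
     - real N * (ln (real N * x) - 1) * (2 * z - 1 - x)"

lemma ln_dsine_reflect: "ln_dsine x N (1 + x - z) = - ln_dsine x N z"
proof -
  have 1: "1 + x - (1 + x - z) + y = z + y" "2 * (1 + x - z) - 1 - x = - (2 * z - 1 - x)" for y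
    by simp_all
  show ?thesis
    unfolding ln_dsine_def 1 sum_subtractf mult_minus_right by linarith
qed

lemma ln_dsine_centre [simp]: "ln_dsine x N ((1 + x) / 2) = 0"
proof -
  have "1 + x - (1 + x) / 2 = (1 + x) / 2"
    by (simp add: field_simps)
  then show ?thesis
    using ln_dsine_reflect[of x N "(1 + x) / 2"] by (simp only:)
qed

text \<open>The second derivative of each summand is a difference of two trigamma values. Right of
  the centre it is nonpositive, since trigamma decreases on the positive reals. The subtracted term
  is affine.\<close>

lemma ln_dsine_concave:
  assumes "x > 0"
  shows "concave_on {(1 + x) / 2..<1 + x} (ln_dsine x N)"
proof -
  have summand: "concave_on {(1 + x) / 2..<1 + x}
      (\<lambda>z. ln_Gamma (z + real l * x) - ln_Gamma (1 + x - z + real l * x))" for l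
  proof (rule f''_le0_imp_concave)
    fix z assume z: "z \<in> {(1 + x) / 2..<1 + x}"
    have "z > 0" "1 + x - z > 0" "real l * x \<ge> 0" using z assms by (auto simp: field_simps)
    then have pos: "z + real l * x > 0" "1 + x - z + real l * x > 0"
      by linarith+
    show "((\<lambda>z. ln_Gamma (z + real l * x) - ln_Gamma (1 + x - z + real l * x)) has_real_derivative
        Digamma (z + real l * x) + Digamma (1 + x - z + real l * x)) (at z)"
      using pos by (auto intro!: derivative_eq_intros)
    have "z + real l * x \<notin> \<int>\<^sub>\<le>\<^sub>0" "1 + x - z + real l * x \<notin> \<int>\<^sub>\<le>\<^sub>0"
      using pos nonpos_Ints_nonpos by force+
    then show "((\<lambda>z. Digamma (z + real l * x) + Digamma (1 + x - z + real l * x)) has_real_derivative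
        Polygamma 1 (z + real l * x) - Polygamma 1 (1 + x - z + real l * x)) (at z)"
      by (auto intro!: derivative_eq_intros)
    have "Polygamma 1 (z + real l * x) \<le> Polygamma 1 (1 + x - z + real l * x)"
    proof (cases "z = 1 + x - z")
      case False
      then show ?thesis
        using z pos Polygamma_real_strict_antimono[of "1 + x - z + real l * x" "z + real l * x" 1]
        by (auto simp: field_simps)
    next
      case True
      then show ?thesis
        by (metis order_refl)
    qed
    then show "Polygamma 1 (z + real l * x) - Polygamma 1 (1 + x - z + real l * x) \<le> 0"
      by simp
  qed simp
  have "concave_on {(1 + x) / 2..<1 + x}
      (\<lambda>z. \<Sum>l<N. ln_Gamma (z + real l * x) - ln_Gamma (1 + x - z + real l * x))"
  proof (induction N)
    case 0
    then show ?case by (simp add: concave_on_const)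
  next
    case (Suc N)
    then show ?case using summand[of N] by (simp add: concave_on_add)
  qed
  moreover have "convex_on {(1 + x) / 2..<1 + x} (\<lambda>z. real N * (ln (real N * x) - 1) * (2 * z - 1 - x))"
    by (rule convex_on_realI[of _ _ "\<lambda>_. real N * (ln (real N * x) - 1) * 2"])
       (auto intro!: derivative_eq_intros)
  ultimately have "concave_on {(1 + x) / 2..<1 + x}
      (\<lambda>z. (\<Sum>l<N. ln_Gamma (z + real l * x) - ln_Gamma (1 + x - z + real l * x))
         - real N * (ln (real N * x) - 1) * (2 * z - 1 - x))"
    by (rule concave_on_diff)
  then show ?thesis
    by (simp add: ln_dsine_def[abs_def])
qed

lemma filterlim_real_times_at_top: "x > 0 \<Longrightarrow> filterlim (\<lambda>N. real N * x) at_top sequentially"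
  by real_asymp

text \<open>Both sums telescope in \<open>l\<close>. The ends at \<open>N\<close> are covered by
  \<open>ln_Gamma_pair_asymp\<close>, and the ends at \<open>0\<close> give the sine by the
  reflection formula.\<close>

lemma ln_dsine_shift_period:
  assumes "0 < x" "0 < z" "z < 1"
  shows "(\<lambda>N. ln_dsine x N (z + x) - ln_dsine x N z) \<longlonglongrightarrow> ln (2 * sin (pi * z))"
proof -
  have shift: "ln_dsine x N (z + x) - ln_dsine x N z
      = (ln_Gamma (z + real N * x) + ln_Gamma (1 - z + real N * x)
          - 2 * (real N * x) * (ln (real N * x) - 1)) - (ln_Gamma z + ln_Gamma (1 - z))" for N
  proof -
    have 1: "(\<Sum>l<N. ln_Gamma (z + x + real l * x) - ln_Gamma (z + real l * x))
        = ln_Gamma (z + real N * x) - ln_Gamma z"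
      using sum_lessThan_telescope[of "\<lambda>l. ln_Gamma (z + real l * x)" N]
      by (simp add: algebra_simps)
    have 2: "(\<Sum>l<N. ln_Gamma (1 + x - z + real l * x) - ln_Gamma (1 - z + real l * x))
        = ln_Gamma (1 - z + real N * x) - ln_Gamma (1 - z)"
      using sum_lessThan_telescope[of "\<lambda>l. ln_Gamma (1 - z + real l * x)" N]
      by (simp add: algebra_simps)
    have "ln_dsine x N (z + x) - ln_dsine x N z
        = (\<Sum>l<N. ln_Gamma (z + x + real l * x) - ln_Gamma (z + real l * x))
        + (\<Sum>l<N. ln_Gamma (1 + x - z + real l * x) - ln_Gamma (1 - z + real l * x))
        - 2 * (real N * x) * (ln (real N * x) - 1)"
      by (simp add: ln_dsine_def sum_subtractf algebra_simps)
    then show ?thesis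
      unfolding 1 2 by (simp add: algebra_simps)
  qed
  have sin: "sin (pi * z) > 0"
    using assms by (intro sin_gt_zero) auto
  have "(\<lambda>N. (ln_Gamma (z + real N * x) + ln_Gamma (1 - z + real N * x)
          - 2 * (real N * x) * (ln (real N * x) - 1)) - (ln_Gamma z + ln_Gamma (1 - z)))
     \<longlonglongrightarrow> ln (2 * pi) - (ln_Gamma z + ln_Gamma (1 - z))"
    by (intro tendsto_intros filterlim_compose[OF ln_Gamma_pair_asymp]
        filterlim_real_times_at_top assms)
  also have "ln (2 * pi) - (ln_Gamma z + ln_Gamma (1 - z)) = ln (2 * sin (pi * z))"
    using ln_Gamma_reflection_real[of z] assms sin by (simp add: ln_mult_pos)
  finally show ?thesis
    by (simp only: shift)
qed

lemma sum_ln_shift: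
  assumes "x > 0" "s > 0"
  shows "(\<Sum>l<N. ln (s * x + real l * x)) = real N * ln x + ln_Gamma (s + real N) - ln_Gamma s"
proof (induction N)
  case (Suc N)
  have "ln (s * x + real N * x) = ln x + ln (s + real N)"
    using assms by (simp add: ln_mult_pos add_pos_nonneg flip: distrib_right)
  moreover have "ln_Gamma (s + real N + 1) = ln (s + real N) + ln_Gamma (s + real N)"
    using assms by (intro ln_Gamma_plus1_real) (simp add: add_pos_nonneg)
  ultimately show ?case
    using Suc by (simp add: algebra_simps)
qed simp

text \<open>A shift by 1 changes each \<open>ln_Gamma\<close> by a logarithm. After \<open>x\<close>
  is factored out, these logarithms add up to \<open>ln_Gamma\<close> differences at
  \<open>z / x\<close> and \<open>1 - z / x\<close>, and the argument ends as for the other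
  period.\<close>

lemma ln_dsine_shift_one:
  assumes "0 < x" "0 < z" "z < x"
  shows "(\<lambda>N. ln_dsine x N (z + 1) - ln_dsine x N z) \<longlonglongrightarrow> ln (2 * sin (pi * (z / x)))"
proof -
  let ?s = "z / x"
  have s: "0 < ?s" "?s < 1" "1 - ?s > 0" "?s * x = z" "(1 - ?s) * x = x - z"
    using assms by (simp_all add: field_simps)
  have shift: "ln_dsine x N (z + 1) - ln_dsine x N z
      = (ln_Gamma (?s + real N) + ln_Gamma (1 - ?s + real N)
          - 2 * real N * (ln (real N) - 1)) - (ln_Gamma ?s + ln_Gamma (1 - ?s))" for N
  proof (cases "N = 0")
    case False
    have 1: "ln_Gamma (z + 1 + real l * x) - ln_Gamma (z + real l * x) = ln (?s * x + real l * x)" for l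
      using ln_Gamma_plus1_real[of "z + real l * x"] assms s(4) by (simp add: add_pos_nonneg algebra_simps)
    have 2: "ln_Gamma (1 + x - z + real l * x) - ln_Gamma (x - z + real l * x)
        = ln ((1 - ?s) * x + real l * x)" for l
    proof -
      have "x - z + real l * x > 0"
        using assms by (simp add: add_pos_nonneg)
      from ln_Gamma_plus1_real[OF this] s(5) show ?thesis
        by (simp add: algebra_simps)
    qed
    have "ln_dsine x N (z + 1) - ln_dsine x N z
        = (\<Sum>l<N. ln_Gamma (z + 1 + real l * x) - ln_Gamma (z + real l * x))
        + (\<Sum>l<N. ln_Gamma (1 + x - z + real l * x) - ln_Gamma (x - z + real l * x))
        - 2 * real N * (ln (real N * x) - 1)"
      by (simp add: ln_dsine_def sum_subtractf algebra_simps)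
    also have "\<dots> = (real N * ln x + ln_Gamma (?s + real N) - ln_Gamma ?s)
        + (real N * ln x + ln_Gamma (1 - ?s + real N) - ln_Gamma (1 - ?s))
        - 2 * real N * (ln (real N * x) - 1)"
      unfolding 1 2 by (simp only: sum_ln_shift[OF assms(1) s(1)] sum_ln_shift[OF assms(1) s(3)])
    also have "ln (real N * x) = ln (real N) + ln x"
      using False assms by (simp add: ln_mult_pos)
    finally show ?thesis
      by (simp add: algebra_simps)
  qed (simp add: ln_dsine_def)
  have sin: "sin (pi * ?s) > 0"
    using s by (intro sin_gt_zero) (auto simp del: times_divide_eq_right)
  have "(\<lambda>N. (ln_Gamma (?s + real N) + ln_Gamma (1 - ?s + real N)
          - 2 * real N * (ln (real N) - 1)) - (ln_Gamma ?s + ln_Gamma (1 - ?s)))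
     \<longlonglongrightarrow> ln (2 * pi) - (ln_Gamma ?s + ln_Gamma (1 - ?s))"
    by (intro tendsto_intros filterlim_compose[OF ln_Gamma_pair_asymp] filterlim_real_sequentially)
  also have "ln (2 * pi) - (ln_Gamma ?s + ln_Gamma (1 - ?s)) = ln (2 * sin (pi * ?s))"
    using ln_Gamma_reflection_real[of ?s] s sin by (simp add: ln_mult_pos)
  finally show ?thesis
    by (simp only: shift)
qed

text \<open>The normalisation \<open>S x = sqrt x\<close>, which starts the induction for the
  reciprocity of sine products. At \<open>z = x\<close> the sum collapses to two Stirling
  remainders, whose limits cancel.\<close>

lemma ln_dsine_at_period:
  assumes "0 < x"
  shows "(\<lambda>N. ln_dsine x N x) \<longlonglongrightarrow> ln x / 2"
proof -
  have eq: "ln_dsine x N x = stirling_rest (real N * x) - stirling_rest (real N) + ln x / 2" if "N > 0" for N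
  proof -
    have sum: "(\<Sum>l<N. ln_Gamma (x + real l * x) - ln_Gamma (1 + real l * x))
        = ln_Gamma (real N * x) - ln_Gamma (real N) - (real N - 1) * ln x" if "N > 0" for N
      using that
    proof (induction N rule: nat_induct_non_zero)
      case 1
      then show ?case by simp
    next
      case (Suc n)
      have "ln_Gamma (real n * x + 1) = ln (real n) + ln x + ln_Gamma (real n * x)"
        using Suc(1) assms ln_Gamma_plus1_real[of "real n * x"] by (simp add: ln_mult_pos)
      moreover have "ln_Gamma (real n + 1) = ln (real n) + ln_Gamma (real n)"
        using Suc(1) by (intro ln_Gamma_plus1_real) simp
      ultimately show ?case
        using Suc by (simp add: algebra_simps)
    qed
    have "ln (real N * x) = ln (real N) + ln x"
      using that assms by (simp add: ln_mult_pos)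
    then show ?thesis
      using sum[OF that] by (simp add: ln_dsine_def stirling_rest_def) (simp add: algebra_simps)
  qed
  have "(\<lambda>N. stirling_rest (real N * x) - stirling_rest (real N) + ln x / 2)
      \<longlonglongrightarrow> ln (2 * pi) / 2 - ln (2 * pi) / 2 + ln x / 2" (is "?f \<longlonglongrightarrow> _")
    by (intro tendsto_intros filterlim_compose[OF stirling_rest_tendsto]
        filterlim_real_times_at_top filterlim_real_sequentially assms)
  then have "?f \<longlonglongrightarrow> ln x / 2"
    by simp
  moreover have "\<forall>\<^sub>F N in sequentially. ?f N = ln_dsine x N x"
    using eventually_gt_at_top[of 0] by eventually_elim (simp add: eq)
  ultimately show ?thesis
    by (rule Lim_transform_eventually)
qed

text \<open>Points half a period to either side of the centre have opposite values by reflection and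
  differ by one full shift, so each value is half of \<open>ln (2 * sin (pi / 2))\<close> in
  absolute value, in the limit.\<close>

lemma ln_dsine_half_periods:
  assumes "0 < x" "x < 1"
  shows "(\<lambda>N. ln_dsine x N ((1 + x) / 2 + x / 2)) \<longlonglongrightarrow> ln 2 / 2"
    and "(\<lambda>N. ln_dsine x N ((1 + x) / 2 + 1 / 2)) \<longlonglongrightarrow> ln 2 / 2"
proof -
  have "ln_dsine x N (1/2) = - ln_dsine x N (1/2 + x)" for N
  proof -
    have "1 + x - (1/2 + x) = 1/2" by simp
    then show ?thesis
      using ln_dsine_reflect[of x N "1/2 + x"] by (simp only:)
  qed
  then have "(\<lambda>N. (ln_dsine x N (1/2 + x) - ln_dsine x N (1/2)) / 2) = (\<lambda>N. ln_dsine x N (1/2 + x))"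
    by (simp only: diff_minus_eq_add mult_2[symmetric]) simp
  moreover have "(\<lambda>N. (ln_dsine x N (1/2 + x) - ln_dsine x N (1/2)) / 2) \<longlonglongrightarrow> ln (2 * sin (pi * (1/2))) / 2"
    using assms by (intro tendsto_intros ln_dsine_shift_period) auto
  moreover have "(1 + x) / 2 + x / 2 = 1/2 + x" by (simp add: field_simps)
  ultimately show "(\<lambda>N. ln_dsine x N ((1 + x) / 2 + x / 2)) \<longlonglongrightarrow> ln 2 / 2"
    by simp
  have "ln_dsine x N (x/2) = - ln_dsine x N (x/2 + 1)" for N
  proof -
    have "1 + x - (x/2 + 1) = x/2" by simp
    then show ?thesis
      using ln_dsine_reflect[of x N "x/2 + 1"] by (simp only:)
  qed
  then have "(\<lambda>N. (ln_dsine x N (x/2 + 1) - ln_dsine x N (x/2)) / 2) = (\<lambda>N. ln_dsine x N (x/2 + 1))"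
    by (simp only: diff_minus_eq_add mult_2[symmetric]) simp
  moreover have "(\<lambda>N. (ln_dsine x N (x/2 + 1) - ln_dsine x N (x/2)) / 2) \<longlonglongrightarrow> ln (2 * sin (pi * ((x/2) / x))) / 2"
    using assms by (intro tendsto_intros ln_dsine_shift_one) auto
  moreover have "(1 + x) / 2 + 1 / 2 = x/2 + 1" by (simp add: field_simps)
  moreover have "(x/2) / x = 1/2" using assms by simp
  then have "ln (2 * sin (pi * ((x/2) / x))) = ln 2" by (simp only:) simp
  ultimately show "(\<lambda>N. ln_dsine x N ((1 + x) / 2 + 1 / 2)) \<longlonglongrightarrow> ln 2 / 2"
    by (simp only:)
qed

section \<open>Riemann sums of the logarithmic sine\<close>

lemma sin_pi_ge:
  assumes "0 \<le> t" "t \<le> 1/2"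
  shows "2 * t \<le> sin (pi * t)"
proof -
  have "concave_on {0..pi/2} (sin :: real \<Rightarrow> real)"
    by (rule f''_le0_imp_concave[where f' = cos and f'' = "\<lambda>x. - sin x"])
       (auto intro!: derivative_eq_intros sin_ge_zero)
  from concave_onD[OF this, of "2 * t" 0 "pi/2"] assms show ?thesis
    by (simp add: mult.commute)
qed

text \<open>Jordan's inequality \<open>sin_pi_ge\<close> yields the integrable majorant
  \<open>ln 2 - ln t\<close>.\<close>

lemma ln_two_sin_integrable: "(\<lambda>t. ln (2 * sin (pi * t))) integrable_on {0..1/2}"
proof -
  have "((\<lambda>t::real. ln t) has_integral (1/2 * ln (1/2) - 1/2) - (0 * ln 0 - 0)) {0..1/2}"
  proof (rule fundamental_theorem_of_calculus_interior)
    show "continuous_on {0..1/2} (\<lambda>t::real. t * ln t - t)"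
    proof -
      have "continuous (at t within {0..1/2}) (\<lambda>t::real. t * ln t - t)" if "t \<in> {0..1/2}" for t :: real
      proof (cases "t = 0")
        case True
        have "((\<lambda>t::real. t * ln t - t) \<longlongrightarrow> 0) (at_right 0)"
          by real_asymp
        then have "((\<lambda>t::real. t * ln t - t) \<longlongrightarrow> 0) (at 0 within {0..1/2})"
          by (simp add: at_within_Icc_at_right)
        then show ?thesis
          using True by (simp add: continuous_within)
      next
        case False
        then have "isCont (\<lambda>t::real. t * ln t - t) t"
          using that by (auto intro!: continuous_intros)
        then show ?thesis
          by (rule continuous_at_imp_continuous_within)
      qed
      then show ?thesis
        by (auto simp: continuous_on_eq_continuous_within)
    qed
    fix t :: real assume "t \<in> {0<..<1/2}"
    then have "((\<lambda>t::real. t * ln t - t) has_real_derivative ln t) (at t)"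
      by (auto intro!: derivative_eq_intros)
    then show "((\<lambda>t::real. t * ln t - t) has_vector_derivative ln t) (at t)"
      by (simp add: has_real_derivative_iff_has_vector_derivative)
  qed simp
  then have ln_int: "(\<lambda>t::real. ln t) integrable_on {0..1/2}"
    by (rule has_integral_integrable)
  show ?thesis
  proof (rule measurable_bounded_by_integrable_imp_integrable)
    show "(\<lambda>t. ln (2 * sin (pi * t))) \<in> borel_measurable (lebesgue_on {0..1/2})"
      by (intro measurable_restrict_space1 measurable_completion) measurable
    show "(\<lambda>t::real. ln 2 - ln t) integrable_on {0..1/2}"
      using ln_int by (intro integrable_diff) auto
    fix t :: real assume t: "t \<in> {0..1/2}"
    show "norm (ln (2 * sin (pi * t))) \<le> ln 2 - ln t"
    proof (cases "t = 0")
      case False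
      then have "ln (2 * (2 * t)) \<le> ln (2 * sin (pi * t))"
        using t sin_pi_ge[of t] by (intro ln_mono) auto
      moreover have "ln (2 * (2 * t)) = ln 2 + ln 2 + ln t"
        using t False ln_mult_pos[of 2 "2 * t"] ln_mult_pos[of 2 t] by auto
      moreover have "ln (2 * sin (pi * t)) \<le> ln 2"
        using t False sin_pi_ge[of t] by (intro ln_mono) auto
      moreover have "ln t \<le> 0" using t False by simp
      moreover have "ln (2::real) \<ge> 0" by simp
      ultimately show ?thesis unfolding real_norm_def abs_le_iff by linarith
    qed simp
  qed auto
qed

text \<open>Euler's argument: by the double angle formula the integral \<open>J\<close> over the
  half interval equals both \<open>A + B\<close> and twice the integral of
  \<open>?g (2 * t)\<close>, where the latter integral is also \<open>A + B\<close>. Hence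
  \<open>J = J / 2\<close>.\<close>

lemma integral_ln_two_sin_half: "integral {0..1/2} (\<lambda>t. ln (2 * sin (pi * t))) = 0"
proof -
  let ?g = "\<lambda>t. ln (2 * sin (pi * t))"
  define J where "J = integral {0..1/2} ?g"
  have int: "?g integrable_on {0..1/4}" "?g integrable_on {1/4..1/2}"
    by (rule integrable_on_subinterval[OF ln_two_sin_integrable]; simp)+
  define A where "A = integral {0..1/4} ?g"
  define B where "B = integral {1/4..1/2} ?g"
  have AB: "A + B = J"
    unfolding A_def B_def J_def by (rule Henstock_Kurzweil_Integration.integral_combine) (auto intro: ln_two_sin_integrable)
  have hA: "(?g has_integral A) {0..1/4}" and hB: "(?g has_integral B) {1/4..1/2}"
    and hJ: "(?g has_integral J) {0..1/2}"
    using int ln_two_sin_integrable by (auto simp: A_def B_def J_def)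
  have "(\<lambda>t. t / 2) ` {0..1/2} = {0..1/4::real}"
    using image_divide_atLeastAtMost[of 2 0 "1/2::real"] by simp
  then have 1: "((\<lambda>t. ?g (2 * t)) has_integral J / 2) {0..1/4}"
    using has_integral_stretch_real[OF hJ, of 2] by simp
  have "(\<lambda>t. -1 * t + 1/2) ` cbox (1/4) (1/2) = {0..1/4::real}"
    using image_affinity_atLeastAtMost[of "-1" "1/2" "1/4" "1/2::real"] by (simp only: box_real) simp
  then have 2: "((\<lambda>t. ?g (1/2 - t)) has_integral B) {0..1/4}"
    using has_integral_affinity[of ?g B "1/4" "1/2" "-1" "1/2"] hB by simp
  have "((\<lambda>t. ?g (2 * t)) has_integral A + B) {0..1/4}"
  \<comment> \<open>At \<open>t = 0\<close> the identity fails: the left side is the default value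
    \<open>ln 0 = 0\<close>, the right side is \<open>ln 2\<close>.\<close>
  proof (rule has_integral_spike_finite[of "{0}"])
    show "((\<lambda>t. ?g t + ?g (1/2 - t)) has_integral A + B) {0..1/4}"
      by (rule has_integral_add[OF hA 2])
    fix t :: real assume t: "t \<in> {0..1/4} - {0}"
    have "sin (pi * t) > 0"
      using t by (intro sin_gt_zero) auto
    moreover have "cos (pi * t) > 0"
      using t by (intro cos_gt_zero) auto
    moreover have "pi * (2 * t) = 2 * (pi * t)" "pi * (1/2 - t) = pi/2 - pi * t"
      by (simp_all add: algebra_simps)
    then have "sin (pi * (2 * t)) = 2 * sin (pi * t) * cos (pi * t)" "sin (pi * (1/2 - t)) = cos (pi * t)"
      using cos_sin_eq[of "pi * t"] by (simp_all only: sin_double of_real_eq_id id_apply)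
    moreover from this have "?g (2 * t) = ln ((2 * sin (pi * t)) * (2 * cos (pi * t)))"
      by (simp only: mult_ac)
    ultimately show "?g (2 * t) = ?g t + ?g (1/2 - t)"
      by (simp only: ln_mult_pos zero_less_mult_iff zero_less_numeral simp_thms)
  qed simp
  from has_integral_unique[OF this 1] AB show ?thesis
    by (simp add: J_def)
qed

text \<open>This is \<open>Vol41 / (4 * pi)\<close>. From \<open>1/2\<close> onwards the integrand
  is decreasing and, up to \<open>5/6\<close>, nonnegative.\<close>

definition ln_sine_mass :: real where
  "ln_sine_mass = integral {1/2..5/6} (\<lambda>t. ln (2 * sin (pi * t)))"

lemma sin_pi_antimono:
  assumes "1/2 \<le> s" "s \<le> t" "t \<le> 1"
  shows "sin (pi * t) \<le> sin (pi * s)"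
proof -
  have "sin (pi * t) = sin (pi * (1 - t))" "sin (pi * s) = sin (pi * (1 - s))"
    by (simp_all add: right_diff_distrib)
  moreover have "sin (pi * (1 - t)) \<le> sin (pi * (1 - s))"
    using assms by (subst sin_mono_le_eq) (auto intro: mult_left_mono order_trans[of "-(pi/2)" 0])
  ultimately show ?thesis by simp
qed

lemma sin_pi_5_6: "sin (pi * (5/6)) = 1/2"
proof -
  have "pi * (5/6) = pi - pi/6" by simp
  then show ?thesis by (simp only: sin_pi_minus sin_30)
qed

lemma Vol41_eq: "Vol41 = 4 * pi * ln_sine_mass"
proof -
  let ?g = "\<lambda>t. ln (2 * sin (pi * t))"
  have "?g integrable_on {1/2..5/6}"
  proof (intro integrable_continuous_real continuous_intros ballI)
    fix t :: real assume "t \<in> {1/2..5/6}"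
    then have "sin (pi * t) > 0"
      by (intro sin_gt_zero) auto
    then show "2 * sin (pi * t) \<noteq> 0" by simp
  qed
  then have "(?g has_integral ln_sine_mass) {1/2..5/6}"
    by (simp add: ln_sine_mass_def integrable_integral)
  moreover have "(?g has_integral 0) {0..1/2}"
    using ln_two_sin_integrable integral_ln_two_sin_half by (simp add: has_integral_iff)
  ultimately have "(?g has_integral 0 + ln_sine_mass) {0..5/6}"
    by (intro has_integral_combine[of 0 "1/2" "5/6"]) auto
  then show ?thesis
    by (simp add: Vol41_def has_integral_iff)
qed

text \<open>Replacing \<open>ln\<close> by its positive part removes the singularity at 1 and does not change the
  integral up to \<open>5/6\<close>.\<close>

definition sine_mass :: "real \<Rightarrow> real" where
  "sine_mass t = integral {1/2..t} (\<lambda>s. ln (max 1 (2 * sin (pi * s))))"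

text \<open>The integrand decreases on \<open>{1/2..1}\<close>, so its integral over a cell lies
  between length times either end value.\<close>

lemma sine_mass_diff_bounds:
  assumes "1/2 \<le> s" "s \<le> t" "t \<le> 1"
  shows "(t - s) * ln (max 1 (2 * sin (pi * t))) \<le> sine_mass t - sine_mass s"
    and "sine_mass t - sine_mass s \<le> (t - s) * ln (max 1 (2 * sin (pi * s)))"
proof -
  let ?f = "\<lambda>s. ln (max 1 (2 * sin (pi * s)))"
  have int: "?f integrable_on {a..b}" for a b :: real
    by (intro integrable_continuous_real continuous_intros) auto
  have "integral {1/2..s} ?f + integral {s..t} ?f = integral {1/2..t} ?f"
    using assms by (intro Henstock_Kurzweil_Integration.integral_combine int) auto
  then have eq: "sine_mass t - sine_mass s = integral {s..t} ?f"
    by (simp add: sine_mass_def)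
  have anti: "?f b \<le> ?f a" if "1/2 \<le> a" "a \<le> b" "b \<le> 1" for a b
  proof -
    have "max 1 (2 * sin (pi * b)) \<le> max 1 (2 * sin (pi * a))"
      using sin_pi_antimono[OF that] by (intro max.mono) auto
    then show ?thesis
      by (intro ln_mono) auto
  qed
  have "integral {s..t} (\<lambda>_. ?f t) \<le> integral {s..t} ?f"
  proof (rule integral_le)
    show "?f t \<le> ?f u" if "u \<in> {s..t}" for u
      using that assms by (intro anti) auto
  qed (auto intro: int)
  then show "(t - s) * ?f t \<le> sine_mass t - sine_mass s"
    using assms by (simp add: eq)
  have "integral {s..t} ?f \<le> integral {s..t} (\<lambda>_. ?f s)"
  proof (rule integral_le)
    show "?f u \<le> ?f s" if "u \<in> {s..t}" for u
      using that assms by (intro anti) auto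
  qed (auto intro: int)
  then show "sine_mass t - sine_mass s \<le> (t - s) * ?f s"
    using assms by (simp add: eq)
qed

lemma sine_mass_half [simp]: "sine_mass (1/2) = 0"
  by (simp add: sine_mass_def)

lemma sine_mass_mono: "1/2 \<le> s \<Longrightarrow> s \<le> t \<Longrightarrow> t \<le> 1 \<Longrightarrow> sine_mass s \<le> sine_mass t"
  using sine_mass_diff_bounds(1)[of s t] by (smt (verit) ln_ge_zero max.cobounded1 mult_nonneg_nonneg)

lemma sine_mass_lipschitz:
  assumes "1/2 \<le> s" "s \<le> t" "t \<le> 1"
  shows "sine_mass t - sine_mass s \<le> (t - s) * ln 2"
proof -
  have "(t - s) * ln (max 1 (2 * sin (pi * s))) \<le> (t - s) * ln 2"
    using assms by (intro mult_left_mono ln_mono) auto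
  then show ?thesis
    using sine_mass_diff_bounds(2)[OF assms] by linarith
qed

lemma sine_mass_5_6: "sine_mass (5/6) = ln_sine_mass"
proof -
  have "max 1 (2 * sin (pi * s)) = 2 * sin (pi * s)" if "s \<in> {1/2..5/6}" for s
    using that sin_pi_antimono[of s "5/6"] sin_pi_5_6 by simp
  then show ?thesis
    unfolding sine_mass_def ln_sine_mass_def by (intro integral_cong) simp
qed

text \<open>Since \<open>2 * sin (pi * (5/6)) = 1\<close>, the positive part vanishes beyond
  \<open>5/6\<close> and the mass stops growing there.\<close>

lemma sine_mass_le:
  assumes "1/2 \<le> t" "t \<le> 1"
  shows "sine_mass t \<le> ln_sine_mass"
proof -
  have "sine_mass 1 - sine_mass (5/6) \<le> 0"
    using sine_mass_diff_bounds(2)[of "5/6" 1] sin_pi_5_6 by simp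
  then show ?thesis
    using sine_mass_mono[of t 1] assms sine_mass_5_6 by simp
qed

lemma ln_sine_mass_bounds: "0 \<le> ln_sine_mass" "ln_sine_mass \<le> 1"
proof -
  show "0 \<le> ln_sine_mass"
    using sine_mass_mono[of "1/2" "5/6"] sine_mass_5_6 by simp
  have "ln_sine_mass \<le> 1/3 * ln 2"
    using sine_mass_lipschitz[of "1/2" "5/6"] sine_mass_5_6 by simp
  also have "\<dots> \<le> 1"
    using ln_2_less_1 by simp
  finally show "ln_sine_mass \<le> 1" .
qed

text \<open>Each term after the first is at most \<open>1 / x\<close> times the integral over the
  cell to its left; the first term costs \<open>ln 2\<close>. The last sample is
  \<open>r + (k - 1) * x\<close>, still at most 1.\<close>

lemma sum_ln_two_sin_upper:
  assumes "x > 0" "1/2 \<le> r" "r + real k * x \<le> 1 + x"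
  shows "(\<Sum>i<k. ln (2 * sin (pi * (r + real i * x)))) \<le> ln 2 + ln_sine_mass / x"
proof (cases k)
  case 0
  then show ?thesis using assms ln_sine_mass_bounds by simp
next
  case (Suc j)
  let ?f = "\<lambda>s. ln (max 1 (2 * sin (pi * s)))"
  \<comment> \<open>At \<open>s = 1\<close> the left side is the default \<open>ln 0 = 0\<close>, so
    the bound holds there too.\<close>
  have g_le: "ln (2 * sin (pi * s)) \<le> ?f s" if "1/2 \<le> s" "s \<le> 1" for s
  proof (cases "sin (pi * s) = 0")
    case False
    moreover have "sin (pi * s) \<ge> 0"
      using sin_pi_antimono[of s 1] that by simp
    ultimately show ?thesis by (intro ln_mono) auto
  qed simp
  have "x * (\<Sum>i<Suc j. ?f (r + real i * x)) \<le> x * ln 2 + (sine_mass (r + real j * x) - sine_mass r)"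
    if "r + real j * x \<le> 1" for j
    using that
  proof (induction j)
    case 0
    have "?f r \<le> ln 2" by (intro ln_mono) auto
    then show ?case using assms by simp
  next
    case (Suc j)
    have "1/2 \<le> r + real j * x" using assms by (simp add: add_increasing2)
    then have "x * ?f (r + real (Suc j) * x) \<le> sine_mass (r + real (Suc j) * x) - sine_mass (r + real j * x)"
      using sine_mass_diff_bounds(1)[of "r + real j * x" "r + real (Suc j) * x"] assms Suc
      by (simp add: algebra_simps)
    moreover have "r + real j * x \<le> 1" using Suc(2) assms by (simp add: algebra_simps)
    ultimately show ?case
      using Suc(1) by (simp add: algebra_simps)
  qed
  moreover have j: "r + real j * x \<le> 1" using assms Suc by (simp add: algebra_simps)
  ultimately have "x * (\<Sum>i<k. ?f (r + real i * x)) \<le> x * ln 2 + (sine_mass (r + real j * x) - sine_mass r)"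
    using Suc by blast
  also have "\<dots> \<le> x * ln 2 + ln_sine_mass"
  proof -
    have "0 \<le> real j * x" using assms by simp
    then have "r \<le> 1" "1/2 \<le> r + real j * x" using j assms by linarith+
    then show ?thesis
      using sine_mass_le[of "r + real j * x"] sine_mass_mono[of "1/2" r] assms j by simp
  qed
  finally have "(\<Sum>i<k. ?f (r + real i * x)) \<le> ln 2 + ln_sine_mass / x"
    using assms by (simp add: field_simps)
  moreover have "(\<Sum>i<k. ln (2 * sin (pi * (r + real i * x)))) \<le> (\<Sum>i<k. ?f (r + real i * x))"
  proof (intro sum_mono g_le)
    fix i assume "i \<in> {..<k}"
    then have "real i * x \<le> real j * x"
      using Suc assms(1) by simp
    then show "r + real i * x \<le> 1"
      using j by linarith
    show "1/2 \<le> r + real i * x"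
      using assms by (simp add: add_increasing2)
  qed
  ultimately show ?thesis by linarith
qed

text \<open>Each term dominates \<open>1 / x\<close> times the integral over the cell to its right.
  All cells end by \<open>5/6\<close>, where the positive part is the logarithm itself.\<close>

lemma sum_ln_two_sin_lower:
  assumes "x > 0" "1/2 \<le> r" "r + real k * x \<le> 5/6"
  shows "(sine_mass (r + real k * x) - sine_mass r) / x \<le> (\<Sum>i<k. ln (2 * sin (pi * (r + real i * x))))"
  using assms(3)
proof (induction k)
  case (Suc k)
  let ?s = "r + real k * x"
  have s: "1/2 \<le> ?s" "?s \<le> 5/6" "r + real (Suc k) * x = ?s + x"
    using assms Suc by (simp_all add: algebra_simps add_increasing2)
  have "sine_mass (?s + x) - sine_mass ?s \<le> x * ln (max 1 (2 * sin (pi * ?s)))"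
    using sine_mass_diff_bounds(2)[of ?s "?s + x"] s Suc assms by simp
  moreover have "max 1 (2 * sin (pi * ?s)) = 2 * sin (pi * ?s)"
    using s sin_pi_antimono[of ?s "5/6"] sin_pi_5_6 by simp
  ultimately have "(sine_mass (?s + x) - sine_mass ?s) / x \<le> ln (2 * sin (pi * ?s))"
    using assms by (simp add: field_simps)
  then show ?case
    using Suc s by (simp add: diff_divide_distrib add.assoc)
qed simp

section \<open>Bounds for the double sine function near its centre\<close>

text \<open>The three-point form of concavity with denominators cleared, in terms of distances from
  the centre.\<close>

lemma ln_dsine_concave_chord:
  assumes "0 < x" "0 \<le> s" "s < t" "t \<le> u" "u < (1 + x) / 2" and c: "c = (1 + x) / 2"
  shows "(u - t) * ln_dsine x N (c + s) + (t - s) * ln_dsine x N (c + u) \<le> (u - s) * ln_dsine x N (c + t)"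
proof -
  define v where "v = (t - s) / (u - s)"
  have v: "0 \<le> v" "v \<le> 1" "v * (u - s) = t - s" "(1 - v) * (u - s) = u - t"
    using assms by (simp_all add: v_def field_simps)
  have "(1 - v) *\<^sub>R (c + s) + v *\<^sub>R (c + u) = c + (s + v * (u - s))"
    by (simp add: algebra_simps)
  then have pt: "(1 - v) *\<^sub>R (c + s) + v *\<^sub>R (c + u) = c + t"
    using v by simp
  have "c + s \<in> {(1 + x) / 2..<1 + x}" "c + u \<in> {(1 + x) / 2..<1 + x}"
    using assms by (auto simp: c field_simps)
  then have "(1 - v) * ln_dsine x N (c + s) + v * ln_dsine x N (c + u) \<le> ln_dsine x N ((1 - v) *\<^sub>R (c + s) + v *\<^sub>R (c + u))"
    by (rule concave_onD[OF ln_dsine_concave[OF assms(1)] v(1,2)])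
  then have "(1 - v) * ln_dsine x N (c + s) + v * ln_dsine x N (c + u) \<le> ln_dsine x N (c + t)"
    unfolding pt .
  then have "(u - s) * ((1 - v) * ln_dsine x N (c + s) + v * ln_dsine x N (c + u)) \<le> (u - s) * ln_dsine x N (c + t)"
    by (rule mult_left_mono) (use assms in simp)
  moreover have "(u - s) * ((1 - v) * ln_dsine x N (c + s) + v * ln_dsine x N (c + u))
      = ((1 - v) * (u - s)) * ln_dsine x N (c + s) + (v * (u - s)) * ln_dsine x N (c + u)"
    by (simp add: algebra_simps)
  ultimately show ?thesis
    unfolding v by simp
qed

text \<open>The value is 0 at the centre and tends to \<open>ln 2 / 2 > 0\<close> at distance
  \<open>1/2\<close>; concavity keeps the function above the chord between them.\<close>

lemma ln_dsine_nonneg: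
  assumes "0 < x" "x < 1" "0 \<le> t" "t \<le> 1/2"
  shows "\<forall>\<^sub>F N in sequentially. ln_dsine x N ((1 + x) / 2 + t) \<ge> 0"
proof (cases "t = 0")
  case False
  have "\<forall>\<^sub>F N in sequentially. ln_dsine x N ((1 + x) / 2 + 1/2) > 0"
    using ln_dsine_half_periods(2)[OF assms(1,2)] by (rule order_tendstoD) simp
  then show ?thesis
  proof eventually_elim
    case (elim N)
    have "t * ln_dsine x N ((1 + x) / 2 + 1/2) \<le> 1/2 * ln_dsine x N ((1 + x) / 2 + t)"
      using ln_dsine_concave_chord[of x 0 t "1/2" "(1 + x) / 2" N] assms False by simp
    moreover have "t * ln_dsine x N ((1 + x) / 2 + 1/2) \<ge> 0"
      using elim assms by simp
    ultimately show ?case by linarith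
  qed
qed simp

text \<open>Concavity together with the equal limits at \<open>c + x/2\<close> and \<open>c + 1/2\<close>, where \<open>c = (1 + x)/2\<close>.\<close>

lemma ln_dsine_le_1:
  assumes "0 < x" "x < 1" "0 \<le> t" "t \<le> x/2"
  shows "\<forall>\<^sub>F N in sequentially. ln_dsine x N ((1 + x) / 2 + t) \<le> 1"
proof (cases "t = x/2")
  case True
  have "\<forall>\<^sub>F N in sequentially. ln_dsine x N ((1 + x) / 2 + x/2) < 1"
    using ln_2_less_1 by (intro order_tendstoD(2)[OF ln_dsine_half_periods(1)[OF assms(1,2)]]) simp
  then show ?thesis
    using True by (auto elim: eventually_mono)
next
  case False
  \<comment> \<open>The chord inequality at \<open>t < x/2 < 1/2\<close>, solved for the value at
    \<open>t\<close>. The limit stays strictly below \<open>1/2 - x/2\<close> because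
    \<open>ln 2 / 2 < 1\<close>, which leaves room for an eventual bound.\<close>
  have "(\<lambda>N. (1/2 - t) * ln_dsine x N ((1 + x) / 2 + x/2) - (x/2 - t) * ln_dsine x N ((1 + x) / 2 + 1/2))
      \<longlonglongrightarrow> (1/2 - t) * (ln 2 / 2) - (x/2 - t) * (ln 2 / 2)"
    by (intro tendsto_intros ln_dsine_half_periods assms)
  moreover have "(1/2 - t) * (ln 2 / 2) - (x/2 - t) * (ln 2 / 2) < 1/2 - x/2"
  proof -
    have "(1/2 - t) * (ln 2 / 2) - (x/2 - t) * (ln 2 / 2) = (1/2 - x/2) * (ln 2 / 2)"
    proof -
      have "(1/2 - t) - (x/2 - t) = 1/2 - x/2" by simp
      then show ?thesis by (simp only: left_diff_distrib[symmetric])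
    qed
    also have "\<dots> < (1/2 - x/2) * 1"
      using assms ln_2_less_1 by (intro mult_strict_left_mono) auto
    finally show ?thesis by simp
  qed
  ultimately have "\<forall>\<^sub>F N in sequentially.
      (1/2 - t) * ln_dsine x N ((1 + x) / 2 + x/2) - (x/2 - t) * ln_dsine x N ((1 + x) / 2 + 1/2) < 1/2 - x/2"
    by (rule order_tendstoD)
  then show ?thesis
  proof eventually_elim
    case (elim N)
    have combine: "X \<le> W * 1" if "X + Y \<le> Z" "Z - Y < W" for X Y Z W :: real
      using that by linarith
    have "(1/2 - x/2) * ln_dsine x N ((1 + x) / 2 + t) + (x/2 - t) * ln_dsine x N ((1 + x) / 2 + 1/2)
        \<le> (1/2 - t) * ln_dsine x N ((1 + x) / 2 + x/2)"
      using ln_dsine_concave_chord[of x t "x/2" "1/2" "(1 + x) / 2" N] assms False by simp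
    then have "(1/2 - x/2) * ln_dsine x N ((1 + x) / 2 + t) \<le> (1/2 - x/2) * 1"
      by (rule combine) (rule elim)
    then show ?case
      by (rule mult_left_le_imp_le) (use assms in simp)
  qed
qed

lemma ln_dsine_minus: "ln_dsine x N ((1 + x) / 2 - t) = - ln_dsine x N ((1 + x) / 2 + t)"
proof -
  have "1 + x - ((1 + x) / 2 + t) = (1 + x) / 2 - t"
    by (simp add: field_simps)
  then show ?thesis
    using ln_dsine_reflect[of x N "(1 + x) / 2 + t"] by (simp only:)
qed

lemma ln_dsine_abs_le_1:
  assumes "0 < x" "x < 1" "1/2 \<le> r" "r \<le> 1/2 + x"
  shows "\<forall>\<^sub>F N in sequentially. \<bar>ln_dsine x N r\<bar> \<le> 1"
proof -
  define t where "t = \<bar>r - (1 + x) / 2\<bar>"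
  have t: "0 \<le> t" "t \<le> x/2" "t \<le> 1/2"
    using assms by (auto simp: t_def abs_le_iff field_simps)
  have r: "r = (1 + x) / 2 + t \<or> r = (1 + x) / 2 - t"
    by (auto simp: t_def abs_if)
  show ?thesis
    using ln_dsine_nonneg[OF assms(1,2) t(1,3)] ln_dsine_le_1[OF assms(1,2) t(1,2)]
  proof eventually_elim
    case (elim N)
    then have "\<bar>ln_dsine x N ((1 + x) / 2 + t)\<bar> \<le> 1"
      by simp
    then show ?case
      using r ln_dsine_minus[of x N t] by (metis abs_minus_cancel)
  qed
qed

lemma ln_dsine_iterate:
  assumes "0 < x" "0 < r" "r + real k * x < 1 + x"
  shows "(\<lambda>N. ln_dsine x N (r + real k * x) - ln_dsine x N r)
      \<longlonglongrightarrow> (\<Sum>i<k. ln (2 * sin (pi * (r + real i * x))))"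
  using assms(3)
proof (induction k)
  case (Suc k)
  have lt: "r + real k * x < 1" "0 < r + real k * x"
    using assms Suc by (simp_all add: algebra_simps add_pos_nonneg)
  have "(\<lambda>N. (ln_dsine x N (r + real k * x) - ln_dsine x N r)
        + (ln_dsine x N (r + real k * x + x) - ln_dsine x N (r + real k * x)))
      \<longlonglongrightarrow> (\<Sum>i<k. ln (2 * sin (pi * (r + real i * x)))) + ln (2 * sin (pi * (r + real k * x)))"
    using lt assms(1) by (intro tendsto_add ln_dsine_shift_period Suc.IH) auto
  moreover have "r + real (Suc k) * x = r + real k * x + x"
    by (simp add: algebra_simps)
  then have "(ln_dsine x N (r + real k * x) - ln_dsine x N r)
        + (ln_dsine x N (r + real k * x + x) - ln_dsine x N (r + real k * x))
      = ln_dsine x N (r + real (Suc k) * x) - ln_dsine x N r" for N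
    by (simp only:)
  ultimately show ?case
    by (simp only: sum.lessThan_Suc)
qed simp

lemma reduce_to_central_period:
  assumes "0 < x" "1/2 \<le> w"
  obtains r k where "1/2 \<le> r" "r \<le> 1/2 + x" "w = r + real k * x"
proof -
  define k where "k = nat \<lfloor>(w - 1/2) / x\<rfloor>"
  have "0 \<le> (w - 1/2) / x" using assms by simp
  then have "real k \<le> (w - 1/2) / x" "(w - 1/2) / x \<le> real k + 1"
    unfolding k_def by linarith+
  then have "real k * x \<le> w - 1/2" "w - 1/2 \<le> (real k + 1) * x"
    using assms by (simp_all add: pos_le_divide_eq pos_divide_le_eq)
  then show ?thesis
    by (intro that[of "w - real k * x" k]) (auto simp: algebra_simps)
qed

section \<open>Reciprocity of sine products\<close>

definition sine_prod :: "nat \<Rightarrow> real \<Rightarrow> real" where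
  "sine_prod n x = (\<Prod>k=1..n. 2 * \<bar>sin (pi * (real k * x))\<bar>)"

lemma sine_prod_0 [simp]: "sine_prod 0 x = 1"
  by (simp add: sine_prod_def)

lemma sine_prod_Suc: "sine_prod (Suc n) x = sine_prod n x * (2 * \<bar>sin (pi * (real (Suc n) * x))\<bar>)"
  by (simp add: sine_prod_def)

lemma J41_term_eq: "J41_term x n = (sine_prod n x)\<^sup>2"
proof -
  have "cmod (1 - exp (2 * of_real pi * \<i> * of_nat k * of_real x)) = 2 * \<bar>sin (pi * (real k * x))\<bar>" for k
  proof -
    have "cmod (1 - exp (2 * of_real pi * \<i> * of_nat k * of_real x))
        = cmod (exp (\<i> * of_real (2 * (pi * (real k * x)))) - 1)"
      by (subst norm_minus_commute) (simp add: mult_ac)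
    then show ?thesis
      by (simp only: dist_exp_i_1) simp
  qed
  then show ?thesis
    unfolding J41_term_def sine_prod_def by (simp only: prod_power_distrib)
qed

lemma abs_sin_pi_add_int: "\<bar>sin (pi * (t + of_int k))\<bar> = \<bar>sin (pi * t)\<bar>"
proof -
  have "sin (pi * (t + of_int k)) = sin (pi * t) * cos (pi * of_int k)"
    by (simp add: distrib_left sin_add)
  moreover have "\<bar>cos (pi * of_int k)\<bar> = 1"
    by simp
  ultimately show ?thesis
    by (simp add: abs_mult)
qed

text \<open>A lattice walk that keeps the argument in \<open>(0, 1 + x)\<close>: raising
  \<open>n\<close> adds the period \<open>x\<close>, raising \<open>m\<close> subtracts the period
  1. Positivity is carried along so that the logarithms of the products can be split.\<close>

theorem sine_prod_reciprocity:
  assumes x: "0 < x" "x < 1" and nz: "\<And>k. 1 \<le> k \<Longrightarrow> k \<le> n \<Longrightarrow> real k * x \<notin> \<int>"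
    and w: "0 < real (Suc n) * x - real m" "real (Suc n) * x - real m < 1 + x"
  shows "sine_prod m (1 / x) > 0 \<and> sine_prod n x > 0 \<and>
    (\<lambda>N. ln_dsine x N (real (Suc n) * x - real m)) \<longlonglongrightarrow> ln x / 2 + ln (sine_prod n x) - ln (sine_prod m (1 / x))"
  using nz w
proof (induction n arbitrary: m)
  case 0
  then have "m = 0"
    using x by (cases m) auto
  then show ?case
    using ln_dsine_at_period[OF x(1)] by simp
next
  case (Suc n)
  let ?L = "\<lambda>n m. ln x / 2 + ln (sine_prod n x) - ln (sine_prod m (1 / x))"
  \<comment> \<open>An argument above \<open>x\<close> is reached from the pair with
    \<open>n\<close> one smaller by a shift of \<open>x\<close>.\<close>
  have up: "sine_prod m (1 / x) > 0 \<and> sine_prod (Suc n) x > 0 \<and>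
      (\<lambda>N. ln_dsine x N (real (Suc (Suc n)) * x - real m)) \<longlonglongrightarrow> ?L (Suc n) m"
    if w: "x < real (Suc (Suc n)) * x - real m" "real (Suc (Suc n)) * x - real m < 1 + x" for m
  proof -
    let ?z = "real (Suc n) * x - real m"
    have z: "0 < ?z" "?z < 1" "real (Suc (Suc n)) * x - real m = ?z + x"
      using w by (simp_all add: algebra_simps)
    have IH: "sine_prod m (1 / x) > 0" "sine_prod n x > 0"
      "(\<lambda>N. ln_dsine x N ?z) \<longlonglongrightarrow> ?L n m"
      using Suc.IH[of m] Suc.prems(1) z x by auto
    have s: "sin (pi * ?z) > 0"
      using z by (intro sin_gt_zero) auto
    have "\<bar>sin (pi * (real (Suc n) * x))\<bar> = \<bar>sin (pi * ?z)\<bar>"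
      using abs_sin_pi_add_int[of ?z "int m"] by simp
    then have S: "sine_prod (Suc n) x = sine_prod n x * (2 * sin (pi * ?z))"
      using s by (simp only: sine_prod_Suc abs_of_pos)
    have "(\<lambda>N. (ln_dsine x N (?z + x) - ln_dsine x N ?z) + ln_dsine x N ?z) \<longlonglongrightarrow> ln (2 * sin (pi * ?z)) + ?L n m"
      by (intro tendsto_add ln_dsine_shift_period IH x z)
    moreover have "ln (sine_prod (Suc n) x) = ln (sine_prod n x) + ln (2 * sin (pi * ?z))"
      unfolding S using s IH by (intro ln_mult_pos) auto
    then have "ln (2 * sin (pi * ?z)) + ?L n m = ?L (Suc n) m"
      by simp
    ultimately have "(\<lambda>N. ln_dsine x N (?z + x)) \<longlonglongrightarrow> ?L (Suc n) m"
      by (simp only: diff_add_cancel)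
    moreover have "sine_prod (Suc n) x > 0"
      unfolding S using s IH by simp
    ultimately show ?thesis
      using IH z(3) by (simp only: simp_thms)
  qed
  let ?w = "real (Suc (Suc n)) * x - real m"
  consider "?w = x" | "?w > x" | "?w < x" by linarith
  then show ?case
  proof cases
    \<comment> \<open>Argument exactly \<open>x\<close> would make \<open>real (Suc n) * x\<close>
      an integer, against the nonintegrality hypothesis.\<close>
    case 1
    then have "real (Suc n) * x = real m"
      by (simp add: algebra_simps)
    then show ?thesis
      using Suc.prems(1)[of "Suc n"] by simp
  next
    case 2
    then show ?thesis
      using up[of m] Suc.prems(3) by blast
  next
    \<comment> \<open>With \<open>m\<close> lowered by 1 the argument becomes
      \<open>?w + 1 > x\<close>, so \<open>up\<close> applies; the shift by 1 then leads back to
      \<open>?w\<close>.\<close>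
    case 3
    have "real m > 0"
    proof -
      have "real (Suc n) * x > 0" using x by simp
      moreover have "real (Suc (Suc n)) * x = real (Suc n) * x + x" by (simp add: algebra_simps)
      ultimately show ?thesis using 3 by linarith
    qed
    then obtain m' where m: "m = Suc m'"
      by (cases m) auto
    have w': "real (Suc (Suc n)) * x - real m' = ?w + 1"
      using m by simp
    have U: "sine_prod m' (1 / x) > 0" "sine_prod (Suc n) x > 0"
      "(\<lambda>N. ln_dsine x N (?w + 1)) \<longlonglongrightarrow> ?L (Suc n) m'"
      using up[of m'] unfolding w' using Suc.prems(2,3) 3 x by auto
    have s: "sin (pi * (?w / x)) > 0"
      using Suc.prems(2) 3 x by (intro sin_gt_zero) (auto simp: divide_less_eq simp del: times_divide_eq_right)
    have "real m * (1 / x) = - (?w / x) + of_int (int (Suc (Suc n)))"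
      using x by (simp add: field_simps)
    then have "\<bar>sin (pi * (real m * (1 / x)))\<bar> = \<bar>sin (pi * - (?w / x))\<bar>"
      by (simp only: abs_sin_pi_add_int)
    also have "\<dots> = sin (pi * (?w / x))"
      using s by (simp only: mult_minus_right sin_minus abs_minus abs_of_pos)
    finally have S: "sine_prod m (1 / x) = sine_prod m' (1 / x) * (2 * sin (pi * (?w / x)))"
      unfolding m by (simp only: sine_prod_Suc)
    have "(\<lambda>N. ln_dsine x N (?w + 1) - (ln_dsine x N (?w + 1) - ln_dsine x N ?w))
        \<longlonglongrightarrow> ?L (Suc n) m' - ln (2 * sin (pi * (?w / x)))"
      by (intro tendsto_diff U ln_dsine_shift_one x Suc.prems(2) 3)
    moreover have "ln (sine_prod m (1 / x)) = ln (sine_prod m' (1 / x)) + ln (2 * sin (pi * (?w / x)))"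
      unfolding S using s U by (intro ln_mult_pos) auto
    then have "?L (Suc n) m' - ln (2 * sin (pi * (?w / x))) = ?L (Suc n) m"
      by simp
    ultimately have "(\<lambda>N. ln_dsine x N ?w) \<longlonglongrightarrow> ?L (Suc n) m"
      by (simp only: diff_diff_eq2 add_diff_cancel_left')
    moreover have "sine_prod m (1 / x) > 0"
      unfolding S using s U by simp
    ultimately show ?thesis
      using U by blast
  qed
qed

section \<open>Comparison of the two sums\<close>

text \<open>Right of the centre: 1 for the central value, 2 for the excess \<open>ln 2\<close> of
  the Riemann sum with a strict margin. Left of the centre the value is eventually at most 0 by
  reflection.\<close>

lemma ln_dsine_upper:
  assumes x: "0 < x" "x < 1" and w: "x \<le> w" "w < 1 + x"
  shows "\<forall>\<^sub>F N in sequentially. ln_dsine x N w \<le> 3 + ln_sine_mass / x"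
proof (cases "w \<ge> (1 + x) / 2")
  case True
  then have "1/2 \<le> w" using x by (simp add: field_simps)
  then obtain r k where r: "1/2 \<le> r" "r \<le> 1/2 + x" "w = r + real k * x"
    using reduce_to_central_period[OF x(1)] by blast
  have "(\<lambda>N. ln_dsine x N w - ln_dsine x N r) \<longlonglongrightarrow> (\<Sum>i<k. ln (2 * sin (pi * (r + real i * x))))"
    unfolding r(3) using r w x by (intro ln_dsine_iterate) auto
  moreover have "(\<Sum>i<k. ln (2 * sin (pi * (r + real i * x)))) < 2 + ln_sine_mass / x"
    using sum_ln_two_sin_upper[of x r k] r w x ln_2_less_1 by simp
  ultimately have "\<forall>\<^sub>F N in sequentially. ln_dsine x N w - ln_dsine x N r < 2 + ln_sine_mass / x"
    by (rule order_tendstoD)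
  then show ?thesis
    using ln_dsine_abs_le_1[OF x r(1,2)] by eventually_elim linarith
next
  case False
  define t where "t = (1 + x) / 2 - w"
  have t: "0 \<le> t" "t \<le> 1/2" "(1 + x) / 2 - t = w"
    using False w x by (auto simp: t_def field_simps)
  have "0 \<le> ln_sine_mass / x" using x ln_sine_mass_bounds by simp
  then have "ln_dsine x N w \<le> 3 + ln_sine_mass / x" if "0 \<le> ln_dsine x N ((1 + x) / 2 + t)" for N
    using that ln_dsine_minus[of x N t] unfolding t(3) by linarith
  then show ?thesis
    using ln_dsine_nonneg[OF x t(1,2)] by (auto elim: eventually_mono)
qed

lemma ln_dsine_lower_centre:
  assumes x: "0 < x" "x < 1" and w: "x / 2 \<le> w" "w \<le> 1 + x / 2"
  shows "\<forall>\<^sub>F N in sequentially. ln_dsine x N w \<ge> - (3 + ln_sine_mass / x)"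
proof (cases "w \<ge> (1 + x) / 2")
  case True
  define t where "t = w - (1 + x) / 2"
  have t: "0 \<le> t" "t \<le> 1/2" "(1 + x) / 2 + t = w"
    using True w x by (auto simp: t_def field_simps)
  have "0 \<le> ln_sine_mass / x" using x ln_sine_mass_bounds by simp
  with ln_dsine_nonneg[OF x t(1,2)] show ?thesis
    unfolding t(3) by (auto elim: eventually_mono)
next
  case False
  have "x \<le> 1 + x - w" "1 + x - w < 1 + x"
    using False x w by (auto simp: field_simps)
  from ln_dsine_upper[OF x this] show ?thesis
    unfolding ln_dsine_reflect by (auto elim: eventually_mono)
qed

text \<open>The central value costs 1. The Riemann sum misses mass at most \<open>x\<close> at each
  end, which costs 2 after division by \<open>x\<close>; one more unit makes the inequality
  strict.\<close>

lemma ln_dsine_lower_peak: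
  assumes x: "0 < x" "x \<le> 1/6" and w: "5/6 - x \<le> w" "w \<le> 5/6"
  shows "\<forall>\<^sub>F N in sequentially. ln_dsine x N w \<ge> ln_sine_mass / x - 4"
proof -
  have "1/2 \<le> w" using x w by simp
  then obtain r k where r: "1/2 \<le> r" "r \<le> 1/2 + x" "w = r + real k * x"
    using reduce_to_central_period[OF x(1)] by blast
  have "(\<lambda>N. ln_dsine x N w - ln_dsine x N r) \<longlonglongrightarrow> (\<Sum>i<k. ln (2 * sin (pi * (r + real i * x))))"
    unfolding r(3) using r w x by (intro ln_dsine_iterate) auto
  moreover have "ln_sine_mass / x - 3 < (\<Sum>i<k. ln (2 * sin (pi * (r + real i * x))))"
  proof -
    have "sine_mass r - sine_mass (1/2) \<le> (r - 1/2) * ln 2"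
      using r x by (intro sine_mass_lipschitz) auto
    also have "\<dots> \<le> x * 1"
      using r x ln_2_less_1 by (intro mult_mono) auto
    finally have 1: "sine_mass r \<le> x" by simp
    have "sine_mass (5/6) - sine_mass w \<le> (5/6 - w) * ln 2"
      using w x by (intro sine_mass_lipschitz) auto
    also have "\<dots> \<le> x * 1"
      using w x ln_2_less_1 by (intro mult_mono) auto
    finally have "ln_sine_mass - 2 * x \<le> sine_mass w - sine_mass r"
      using 1 sine_mass_5_6 by simp
    then have "(ln_sine_mass - 2 * x) / x \<le> (sine_mass w - sine_mass r) / x"
      using x by (intro divide_right_mono) auto
    also have "\<dots> \<le> (\<Sum>i<k. ln (2 * sin (pi * (r + real i * x))))"
      using sum_ln_two_sin_lower[OF x(1) r(1), of k] w unfolding r(3) by simp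
    finally show ?thesis
      using x by (simp add: diff_divide_distrib)
  qed
  ultimately have "\<forall>\<^sub>F N in sequentially. ln_sine_mass / x - 3 < ln_dsine x N w - ln_dsine x N r"
    by (rule order_tendstoD)
  moreover have "\<forall>\<^sub>F N in sequentially. \<bar>ln_dsine x N r\<bar> \<le> 1"
    using x r by (intro ln_dsine_abs_le_1) auto
  ultimately show ?thesis
    by eventually_elim linarith
qed

text \<open>A window of length \<open>x\<close> is what lets every \<open>m\<close> find an
  \<open>n\<close>. For small \<open>x\<close> it lies just below the peak \<open>5/6\<close>;
  otherwise a window near the centre suffices, as \<open>ln_sine_mass / x\<close> is then at most 6
  and \<open>15 = 3 + 2 * 6\<close>.\<close>

lemma ln_dsine_lower_window:
  assumes x: "0 < x" "x < 1"
  obtains \<tau> where "0 < \<tau>" "\<tau> < 1"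
    "\<And>w. \<tau> \<le> w \<Longrightarrow> w < \<tau> + x \<Longrightarrow> \<forall>\<^sub>F N in sequentially. ln_dsine x N w \<ge> ln_sine_mass / x - 15"
proof (cases "x \<le> 1/6")
  case True
  show ?thesis
  proof (rule that[of "5/6 - x"])
    fix w assume "5/6 - x \<le> w" "w < 5/6 - x + x"
    then show "\<forall>\<^sub>F N in sequentially. ln_dsine x N w \<ge> ln_sine_mass / x - 15"
      using ln_dsine_lower_peak[OF x(1) True, of w] by (auto elim: eventually_mono)
  qed (use x True in auto)
next
  case False
  have "ln_sine_mass / x \<le> 1 / (1/6)"
    using False ln_sine_mass_bounds by (intro frac_le) auto
  then have le: "ln_sine_mass / x - 15 \<le> - (3 + ln_sine_mass / x)"
    by simp
  show ?thesis
  proof (rule that[of "x/2"])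
    fix w assume "x/2 \<le> w" "w < x/2 + x"
    then have "\<forall>\<^sub>F N in sequentially. ln_dsine x N w \<ge> - (3 + ln_sine_mass / x)"
      using x by (intro ln_dsine_lower_centre) auto
    then show "\<forall>\<^sub>F N in sequentially. ln_dsine x N w \<ge> ln_sine_mass / x - 15"
      using le by (auto elim: eventually_mono)
  qed (use x in auto)
qed

section \<open>From pairs of terms to the two sums\<close>

lemma J41_finite_sum:
  assumes "b > 0" "real b * y \<in> \<int>"
  shows "J41 y = (\<Sum>n<b. (sine_prod n y)\<^sup>2)"
  unfolding J41_def J41_term_eq
proof (rule suminf_finite)
  fix n assume "n \<notin> {..<b}"
  then have "b \<in> {1..n}" using assms by auto
  moreover obtain j where "real b * y = of_int j"
    using assms(2) by (elim Ints_cases)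
  then have "2 * \<bar>sin (pi * (real b * y))\<bar> = 0"
    by simp
  ultimately have "sine_prod n y = 0"
    unfolding sine_prod_def by (intro prod_zero) auto
  then show "(sine_prod n y)\<^sup>2 = 0" by simp
qed simp

lemma multiple_not_int:
  assumes "coprime a b" "1 \<le> k" "k < b"
  shows "real k * (real a / real b) \<notin> \<int>"
proof
  assume "real k * (real a / real b) \<in> \<int>"
  then obtain j where "real k * (real a / real b) = of_int j"
    by (elim Ints_cases)
  then have "real k * real a = of_int j * real b"
    using assms by (simp add: field_simps)
  then have "int k * int a = j * int b"
    by (metis of_int_eq_iff of_int_mult of_int_of_nat_eq)
  then have "int b dvd int k * int a"
    by simp
  then have "b dvd k * a"
    by (metis int_dvd_int_iff of_nat_mult)
  then have "b dvd k"
    using assms(1) by (simp add: coprime_commute coprime_dvd_mult_left_iff)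
  then show False
    using assms by (auto dest: dvd_imp_le)
qed

lemma card_floor_fibre:
  assumes "0 < x" "x < 1"
  shows "real (card {n. n < b \<and> nat \<lfloor>real n * x\<rfloor> = m}) \<le> 2 / x"
proof (cases "{n. n < b \<and> nat \<lfloor>real n * x\<rfloor> = m} = {}")
  case False
  let ?S = "{n. n < b \<and> nat \<lfloor>real n * x\<rfloor> = m}"
  define n0 where "n0 = Min ?S"
  have fin: "finite ?S" by simp
  have n0: "n0 \<in> ?S" unfolding n0_def by (rule Min_in[OF fin False])
  have "?S \<subseteq> {n0..n0 + nat \<lfloor>1 / x\<rfloor>}"
  proof
    fix n assume n: "n \<in> ?S"
    have "n0 \<le> n" unfolding n0_def using fin n by (rule Min_le)
    moreover have "\<lfloor>real n * x\<rfloor> = \<lfloor>real n0 * x\<rfloor>"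
      using n n0 assms by (auto simp: nat_eq_iff2)
    then have "(real n - real n0) * x < 1"
      unfolding left_diff_distrib by linarith
    then have "real n - real n0 \<le> 1 / x"
      using assms by (simp add: field_simps)
    then have "int n - int n0 \<le> \<lfloor>1 / x\<rfloor>"
      by (simp add: le_floor_iff)
    then have "n \<le> n0 + nat \<lfloor>1 / x\<rfloor>" by linarith
    ultimately show "n \<in> {n0..n0 + nat \<lfloor>1 / x\<rfloor>}" by simp
  qed
  then have "card ?S \<le> card {n0..n0 + nat \<lfloor>1 / x\<rfloor>}"
    by (intro card_mono) auto
  then have "real (card ?S) \<le> real (nat \<lfloor>1 / x\<rfloor>) + 1"
    by simp
  also have "\<dots> \<le> 1 / x + 1"
    using assms by simp
  also have "\<dots> \<le> 2 / x"
    using assms by (simp add: field_simps)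
  finally show ?thesis .
next
  case True
  then show ?thesis using assms by (simp only: True card.empty) simp
qed

text \<open>The choice of \<open>?m n\<close> puts the argument in \<open>{x..<1 + x}\<close>. The
  factor \<open>2 / x\<close> counts the \<open>n\<close> sharing one \<open>m\<close>, and
  \<open>- ln x / 2\<close> comes from \<open>S x = sqrt x\<close>; together they account for the
  logarithmic error.\<close>

lemma J41_le:
  assumes "0 < a" "a < b" "coprime a b" and x: "x = real a / real b"
  shows "J41 x \<le> 2 / x * (exp (3 + ln_sine_mass / x - ln x / 2))\<^sup>2 * J41 (1 / x)"
proof -
  have x01: "0 < x" "x < 1" using assms by simp_all
  let ?E = "(exp (3 + ln_sine_mass / x - ln x / 2))\<^sup>2"
  let ?m = "\<lambda>n. nat \<lfloor>real n * x\<rfloor>"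
  have ml: "?m n < a" if "n < b" for n
  proof -
    have "real n * x < real b * x" using that x01 by simp
    also have "\<dots> = real a" using assms by simp
    finally have "\<lfloor>real n * x\<rfloor> < int a"
      by (simp add: floor_less_iff)
    then show ?thesis
      using assms by linarith
  qed
  have le: "(sine_prod n x)\<^sup>2 \<le> ?E * (sine_prod (?m n) (1 / x))\<^sup>2" if n: "n < b" for n
  proof -
    let ?w = "real (Suc n) * x - real (?m n)"
    have "0 \<le> real n * x" using x01 by simp
    then have "real (?m n) \<le> real n * x" "real n * x < real (?m n) + 1"
      by linarith+
    then have w: "x \<le> ?w" "?w < 1 + x"
      by (simp_all add: algebra_simps)
    have nz: "real k * x \<notin> \<int>" if "1 \<le> k" "k \<le> n" for k
      unfolding x using that n assms by (intro multiple_not_int) auto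
    have R: "sine_prod (?m n) (1 / x) > 0" "sine_prod n x > 0"
      "(\<lambda>N. ln_dsine x N ?w) \<longlonglongrightarrow> ln x / 2 + ln (sine_prod n x) - ln (sine_prod (?m n) (1 / x))"
      using sine_prod_reciprocity[OF x01 nz, of n "?m n"] w x01 by auto
    have "ln x / 2 + ln (sine_prod n x) - ln (sine_prod (?m n) (1 / x)) \<le> 3 + ln_sine_mass / x"
      using tendsto_upperbound[OF R(3) ln_dsine_upper[OF x01 w]] by simp
    then have "ln (sine_prod n x) \<le> (3 + ln_sine_mass / x - ln x / 2) + ln (sine_prod (?m n) (1 / x))"
      by linarith
    then have "exp (ln (sine_prod n x)) \<le> exp ((3 + ln_sine_mass / x - ln x / 2) + ln (sine_prod (?m n) (1 / x)))"
      by (simp only: exp_le_cancel_iff)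
    then have "sine_prod n x \<le> exp (3 + ln_sine_mass / x - ln x / 2) * sine_prod (?m n) (1 / x)"
      using R by (simp only: exp_add exp_ln)
    then have "(sine_prod n x)\<^sup>2 \<le> (exp (3 + ln_sine_mass / x - ln x / 2) * sine_prod (?m n) (1 / x))\<^sup>2"
      using R by (intro power_mono) auto
    then show ?thesis
      by (simp only: power_mult_distrib)
  qed
  have Jx: "J41 x = (\<Sum>n<b. (sine_prod n x)\<^sup>2)"
    using assms by (intro J41_finite_sum) auto
  have Ji: "J41 (1 / x) = (\<Sum>m<a. (sine_prod m (1 / x))\<^sup>2)"
    using assms by (intro J41_finite_sum) auto
  have "J41 x \<le> (\<Sum>n<b. ?E * (sine_prod (?m n) (1 / x))\<^sup>2)"
    unfolding Jx by (intro sum_mono le) auto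
  also have "\<dots> = (\<Sum>m<a. \<Sum>n\<in>{n \<in> {..<b}. ?m n = m}. ?E * (sine_prod (?m n) (1 / x))\<^sup>2)"
    using ml by (intro sum.group[symmetric]) auto
  also have "\<dots> = (\<Sum>m<a. real (card {n. n < b \<and> ?m n = m}) * (?E * (sine_prod m (1 / x))\<^sup>2))"
    by (intro sum.cong refl) simp
  also have "\<dots> \<le> (\<Sum>m<a. 2 / x * (?E * (sine_prod m (1 / x))\<^sup>2))"
    by (intro sum_mono mult_right_mono card_floor_fibre x01) simp
  also have "\<dots> = 2 / x * ?E * J41 (1 / x)"
    unfolding Ji by (simp only: sum_distrib_left mult.assoc)
  finally show ?thesis .
qed

lemma J41_ge:
  assumes "0 < a" "a < b" "coprime a b" and x: "x = real a / real b"
  shows "(exp (ln_sine_mass / x - 15))\<^sup>2 * J41 (1 / x) \<le> J41 x"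
proof -
  have x01: "0 < x" "x < 1" using assms by simp_all
  obtain \<tau> where \<tau>: "0 < \<tau>" "\<tau> < 1" and
    low: "\<And>w. \<tau> \<le> w \<Longrightarrow> w < \<tau> + x \<Longrightarrow> \<forall>\<^sub>F N in sequentially. ln_dsine x N w \<ge> ln_sine_mass / x - 15"
    using ln_dsine_lower_window[OF x01] by blast
  \<comment> \<open>As \<open>1/x > 1\<close>, distinct \<open>m\<close> get distinct \<open>n = f m\<close> with \<open>(n + 1) x - m\<close> in the window.\<close>
  define f where "f m = nat (\<lceil>(real m + \<tau>) / x\<rceil> - 1)" for m
  have f: "\<tau> \<le> real (Suc (f m)) * x - real m" "real (Suc (f m)) * x - real m < \<tau> + x" for m
  proof -
    have "(real m + \<tau>) / x > 0" using \<tau> x01 by (simp add: add_nonneg_pos)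
    then have "(real m + \<tau>) / x \<le> real (Suc (f m))" "real (Suc (f m)) < (real m + \<tau>) / x + 1"
      unfolding f_def by linarith+
    then show "\<tau> \<le> real (Suc (f m)) * x - real m" "real (Suc (f m)) * x - real m < \<tau> + x"
      using x01 by (simp_all add: field_simps)
  qed
  have inj: "inj f"
  proof (rule injI)
    fix m m' assume eq: "f m = f m'"
    have "\<bar>real m - real m'\<bar> < 1"
      using f[of m] f[of m'] x01 unfolding eq by linarith
    then show "m = m'" by simp
  qed
  \<comment> \<open>From \<open>m \<le> a - 1\<close> and \<open>\<tau> < 1\<close> one gets
    \<open>(f m + 1) * x < a + x = (b + 1) * x\<close>. This keeps the index in the range where the
    products do not vanish.\<close>
  have fb: "f m < b" if "m < a" for m
  proof -
    have "real (Suc (f m)) * x < real a - 1 + \<tau> + x"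
      using f(2)[of m] that by linarith
    also have "\<dots> < real b * x + x"
      using \<tau> assms by simp
    finally have "real (Suc (f m)) * x < (real b + 1) * x"
      by (simp add: algebra_simps)
    then show ?thesis
      using x01 by simp
  qed
  let ?E = "(exp (ln_sine_mass / x - 15))\<^sup>2"
  have le: "?E * (sine_prod m (1 / x))\<^sup>2 \<le> (sine_prod (f m) x)\<^sup>2" if "m < a" for m
  proof -
    let ?w = "real (Suc (f m)) * x - real m"
    have nz: "real k * x \<notin> \<int>" if "1 \<le> k" "k \<le> f m" for k
      unfolding x using that fb[OF \<open>m < a\<close>] assms by (intro multiple_not_int) auto
    have R: "sine_prod m (1 / x) > 0" "sine_prod (f m) x > 0"
      "(\<lambda>N. ln_dsine x N ?w) \<longlonglongrightarrow> ln x / 2 + ln (sine_prod (f m) x) - ln (sine_prod m (1 / x))"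
      using sine_prod_reciprocity[OF x01 nz, of "f m" m] f[of m] \<tau> by auto
    have "ln_sine_mass / x - 15 \<le> ln x / 2 + ln (sine_prod (f m) x) - ln (sine_prod m (1 / x))"
      using tendsto_lowerbound[OF R(3) low[OF f]] by simp
    \<comment> \<open>Moving \<open>ln x / 2\<close> to the other side only strengthens the lower
      bound, so it is dropped.\<close>
    moreover have "ln x < 0" using x01 by simp
    ultimately have "(ln_sine_mass / x - 15) + ln (sine_prod m (1 / x)) \<le> ln (sine_prod (f m) x)"
      by linarith
    then have "exp ((ln_sine_mass / x - 15) + ln (sine_prod m (1 / x))) \<le> exp (ln (sine_prod (f m) x))"
      by (simp only: exp_le_cancel_iff)
    then have "exp (ln_sine_mass / x - 15) * sine_prod m (1 / x) \<le> sine_prod (f m) x"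
      using R by (simp only: exp_add exp_ln)
    then have "(exp (ln_sine_mass / x - 15) * sine_prod m (1 / x))\<^sup>2 \<le> (sine_prod (f m) x)\<^sup>2"
      using R by (intro power_mono) auto
    then show ?thesis
      by (simp only: power_mult_distrib)
  qed
  have Jx: "J41 x = (\<Sum>n<b. (sine_prod n x)\<^sup>2)"
    using assms by (intro J41_finite_sum) auto
  have Ji: "J41 (1 / x) = (\<Sum>m<a. (sine_prod m (1 / x))\<^sup>2)"
    using assms by (intro J41_finite_sum) auto
  have "?E * J41 (1 / x) \<le> (\<Sum>m<a. (sine_prod (f m) x)\<^sup>2)"
    unfolding Ji sum_distrib_left by (intro sum_mono le) auto
  also have "\<dots> = (\<Sum>n\<in>f ` {..<a}. (sine_prod n x)\<^sup>2)"
    using inj by (subst sum.reindex) (auto intro: inj_on_subset)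
  also have "\<dots> \<le> J41 x"
    unfolding Jx using fb by (intro sum_mono2) auto
  finally show ?thesis .
qed

theorem theorem2:
  shows "\<exists>C::real. C > 0 \<and>
    (\<forall>x::real. x \<in> \<rat> \<and> 0 < x \<and> x < 1 \<longrightarrow>
      \<bar>h x - Vol41 / (2 * pi * x)\<bar> \<le> C * (1 + \<bar>ln x\<bar>))"
proof (intro exI conjI allI impI)
  \<comment> \<open>Squaring doubles the loss of 15 in \<open>J41_ge\<close>; the upper error
    \<open>7 - 2 * ln x\<close> fits under the same constant.\<close>
  show "(0::real) < 30" by simp
  fix x :: real assume x: "x \<in> \<rat> \<and> 0 < x \<and> x < 1"
  then obtain a b :: nat where ab: "b \<noteq> 0" "\<bar>x\<bar> = real a / real b" "coprime a b"
    using Rats_abs_nat_div_natE by metis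
  have xab: "x = real a / real b" using x ab by simp
  have "0 < a" "a < b"
    using x ab unfolding xab by (auto simp: zero_less_divide_iff)
  note ab' = this ab(3) xab
  let ?J = "J41 x" and ?J' = "J41 (1 / x)"
  have pos: "?J > 0" "?J' > 0"
    using J41_ge_1[of x] J41_ge_1[of "1 / x"] x by (auto intro: less_le_trans[OF zero_less_one])
  have hx: "h x = ln ?J - ln ?J'"
    using pos by (simp add: h_def ln_div)
  have V: "Vol41 / (2 * pi * x) = 2 * (ln_sine_mass / x)"
    using x by (simp add: Vol41_eq)
  have "ln ?J \<le> ln (2 / x * (exp (3 + ln_sine_mass / x - ln x / 2))\<^sup>2 * ?J')"
    using J41_le[OF ab'] pos by (intro ln_mono) auto
  also have "\<dots> = ln 2 - ln x + 2 * (3 + ln_sine_mass / x - ln x / 2) + ln ?J'"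
    using pos x by (simp add: ln_mult_pos ln_div ln_realpow)
  finally have upper: "h x - Vol41 / (2 * pi * x) \<le> 7 - 2 * ln x"
    unfolding hx V using ln_2_less_1 by simp
  have "ln ((exp (ln_sine_mass / x - 15))\<^sup>2 * ?J') \<le> ln ?J"
    using J41_ge[OF ab'] pos by (intro ln_mono) auto
  moreover have "ln ((exp (ln_sine_mass / x - 15))\<^sup>2 * ?J') = 2 * (ln_sine_mass / x - 15) + ln ?J'"
    using pos by (simp add: ln_mult_pos ln_realpow)
  ultimately have lower: "- 30 \<le> h x - Vol41 / (2 * pi * x)"
    unfolding hx V by simp
  have "ln x \<le> 0" "\<bar>ln x\<bar> = - ln x" using x by simp_all
  moreover have "\<bar>D\<bar> \<le> 30 * (1 + - l)" if "l \<le> 0" "D \<le> 7 - 2 * l" "- 30 \<le> D" for D l :: real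
    using that by (intro abs_leI) auto
  ultimately show "\<bar>h x - Vol41 / (2 * pi * x)\<bar> \<le> 30 * (1 + \<bar>ln x\<bar>)"
    using upper lower by (simp only:)
qed

end
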